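(* Let $(X_n)_{n\in\mathbb{N}}$ be the BST chain and let $X_\infty$ be its limit, a random probability measure on $\partial\mathbb{V}$. Let $\Sigma_\infty:\partial\mathbb{V}\to[0,\infty]$ be defined by $$\Sigma_\infty(v):=-\int_{\partial\mathbb{V}}\log_2\bigl(d_{\mathbb{V}}(u,v)\bigr)\,X_\infty(du),\qquad v\in\partial\mathbb{V}.$$ Let $\alpha_0:=\log_2\rho_0=0.33464\ldots$, where $\rho_0=1.26107\cdots$ is the smaller of the two roots of the equation $2e\log(\rho)=\rho$, $\rho>0$. (a) $E\|\Sigma_\infty\|_\infty<\infty$. (b) With probability 1, $\Sigma_\infty$ is H\"older continuous on $(\partial\mathbb{V},d_{\mathbb{V}})$ with exponent $\alpha$ for all $\alpha<\alpha_0$. (c) As $n\to\infty$, $$\left\|\frac1n\,\mathrm{mSil}(X_n)-\Sigma_\infty\right\|_\infty\to0\qquad\text{almost surely and in mean}.$$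
   Context: Nodes. $\mathbb{V}=\bigsqcup_{k\ge 0}\{0,1\}^k$ is the set of all finite 0--1 sequences (nodes), $\varnothing$ is the empty sequence, $|u|$ is the length of $u$, and $\partial\mathbb{V}=\{0,1\}^\infty$ is the set of infinite 0--1 sequences; $\bar{\mathbb{V}}=\mathbb{V}\cup\partial\mathbb{V}$. For $u=(u_1,\dots,u_k)\in\mathbb{V}$ with $k\ge1$ write $\bar u=(u_1,\dots,u_{k-1})$ (the parent). For $v=(v_k)_{k\in\mathbb{N}}\in\partial\mathbb{V}$ write $v(k)=(v_1,\dots,v_k)\in\mathbb{V}$. Write $u\le v$ if $u$ is a prefix of $v$ ($v\in\bar{\mathbb{V}}$), $u\wedge v$ for the longest common prefix, and $A_u=\{v\in\partial\mathbb{V}: v\ge u\}$. Metric and function space. On $\mathbb{V}$, $d_{\mathbb{V}}(u,v)=2^{-|u\wedge v|}-\frac12(2^{-|u|}+2^{-|v|})$; the completion is the compact metric space $\bar{\mathbb{V}}$, and for $u,v\in\partial\mathbb{V}$ one has $d_{\mathbb{V}}(u,v)=2^{-|u\wedge v|}$ if $u\ne v$ and $d_{\mathbb{V}}(u,u)=0$. The convention $-\log_2 0=+\infty$ is used. For a function $f$ on $\partial\mathbb{V}$, $\|f\|_\infty=\sup_{v\in\partial\mathbb{V}}|f(v)|$. A real function $f$ on $(\partial\mathbb{V},d_{\mathbb{V}})$ is (globally) H\"older continuous with exponent $\alpha$ if there is a constant $C<\infty$ with $|f(u)-f(v)|\le C\,d_{\mathbb{V}}(u,v)^\alpha$ for all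 (distinct) $u,v\in\partial\mathbb{V}$. Convergence in mean to $0$ means that the expectations tend to $0$. Binary trees. A binary tree is a prefix-stable set $x\subset\mathbb{V}$ ($u\in x$ and $v\le u$ imply $v\in x$). For a finite nonempty binary tree $x$: $\partial x=\{u\in\mathbb{V}:\bar u\in x,\ u\notin x\}$ is the set of external nodes, and $\sigma(x,u)=\#\{v\in x:u\le v\}$ for $u\in\mathbb{V}$. The metric silhouette of $x$ is the function on $\partial\mathbb{V}$ given by $\mathrm{mSil}(x)(v)=\sum_{k=1}^\infty\sigma(x,v(k))$. BST chain. This is the Markov chain $(X_n)_{n\in\mathbb{N}}$ of finite binary trees with $X_1=\{\varnothing\}$ in which, given $X_n$, the tree $X_{n+1}$ is $X_n\cup\{u\}$ with $u$ chosen uniformly at random from the $n+1$ external nodes of $X_n$; it is the sequence of trees produced by the binary search tree algorithm applied to i.i.d. uniform$(0,1)$ input. Its limit $X_\infty$ is the random probability measure on $\partial\mathbb{V}$ that is the almost sure weak limit, on $(\bar{\mathbb{V}},d_{\mathbb{V}})$, of the uniform distributions on the sets $X_n$; equivalently, almost surely $X_\infty(A_u)=\lim_{n\to\infty}\sigma(X_n,u)/n$ for all $u\in\mathbb{V}$. *)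

theory Defs
  imports "HOL-Probability.Probability" "HOL-Library.Sublist"
begin

section \<open>Nodes, rays and the metric\<close>

text \<open>
  A ray is an infinite 0--1 sequence, an element of the boundary. Rays are indexed from 0, so
  \<open>(v\<^sub>1, v\<^sub>2, \<dots>)\<close> is \<open>v 0, v 1, \<dots>\<close>, and \<open>v(k)\<close> is \<open>ray_prefix v k\<close>.
\<close>

type_synonym node = "bool list"
type_synonym ray = "nat \<Rightarrow> bool"

definition ray_prefix :: "ray \<Rightarrow> nat \<Rightarrow> node" where
  "ray_prefix v k = map v [0..<k]"

text \<open>The set of all finite and infinite 0--1 sequences.\<close>

datatype vbar = Node node | End ray

fun vlen :: "vbar \<Rightarrow> enat" where
  "vlen (Node u) = enat (length u)"
| "vlen (End v) = \<infinity>"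

fun prefix_of :: "node \<Rightarrow> vbar \<Rightarrow> bool" where
  "prefix_of u (Node w) \<longleftrightarrow> prefix u w"
| "prefix_of u (End v) \<longleftrightarrow> ray_prefix v (length u) = u"

text \<open>The length of the longest common prefix; it is \<open>\<infinity>\<close> exactly for a ray and itself.\<close>

definition meet_len :: "vbar \<Rightarrow> vbar \<Rightarrow> enat" where
  "meet_len u v = (SUP w \<in> {w. prefix_of w u \<and> prefix_of w v}. enat (length w))"

fun half_pow :: "enat \<Rightarrow> real" where
  "half_pow (enat k) = (1 / 2) ^ k"
| "half_pow \<infinity> = 0"

lemma half_pow_antimono: "a \<le> b \<Longrightarrow> half_pow b \<le> half_pow a"
  by (cases a; cases b) (auto intro: power_decreasing)

lemma half_pow_strict: "a < b \<Longrightarrow> half_pow b < half_pow a"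
  by (cases a; cases b) (auto intro: power_strict_decreasing)

lemma length_ray_prefix [simp]: "length (ray_prefix v k) = k"
  by (simp add: ray_prefix_def)

lemma take_ray_prefix: "take j (ray_prefix v k) = ray_prefix v (min j k)"
  by (simp add: ray_prefix_def take_map min_def)

lemma prefix_of_take: "prefix_of w u \<Longrightarrow> prefix_of (take k w) u"
proof (cases u)
  case (Node x)
  assume "prefix_of w u"
  then show ?thesis using Node by (auto intro: prefix_order.trans take_is_prefix)
next
  case (End v)
  assume "prefix_of w u"
  then have "ray_prefix v (length w) = w" using End by simp
  then have "take k w = ray_prefix v (min k (length w))" by (metis take_ray_prefix)
  then show ?thesis using End by (simp add: min.commute)
qed

lemma prefix_of_unique: "prefix_of w u \<Longrightarrow> prefix_of w' u \<Longrightarrow> length w = length w' \<Longrightarrow> w = w'"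
  by (cases u) (auto simp: prefix_def)

lemma prefix_of_len: "prefix_of w u \<Longrightarrow> enat (length w) \<le> vlen u"
  by (cases u) (auto dest: prefix_length_le)

lemma le_meet_len: "enat k \<le> meet_len u v \<longleftrightarrow> (\<exists>w. length w = k \<and> prefix_of w u \<and> prefix_of w v)"
proof
  assume le: "enat k \<le> meet_len u v"
  have "\<exists>w. k \<le> length w \<and> prefix_of w u \<and> prefix_of w v"
  proof (cases k)
    case 0
    have "prefix_of [] u" "prefix_of [] v" by (cases u; cases v; simp add: ray_prefix_def)+
    then show ?thesis using 0 by auto
  next
    case (Suc j)
    then have "enat j < meet_len u v" using le by (metis Suc_ile_eq)
    then obtain w where "prefix_of w u" "prefix_of w v" "enat j < enat (length w)"
      by (auto simp: meet_len_def less_SUP_iff)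
    then show ?thesis using Suc by (auto intro!: exI[of _ w])
  qed
  then obtain w where "k \<le> length w" "prefix_of w u" "prefix_of w v" by blast
  then show "\<exists>w. length w = k \<and> prefix_of w u \<and> prefix_of w v"
    by (intro exI[of _ "take k w"]) (auto intro: prefix_of_take)
next
  assume "\<exists>w. length w = k \<and> prefix_of w u \<and> prefix_of w v"
  then show "enat k \<le> meet_len u v"
    by (auto simp: meet_len_def intro: SUP_upper2)
qed

lemma meet_len_commute: "meet_len u v = meet_len v u"
  by (simp add: meet_len_def conj_commute)

lemma meet_len_le: "meet_len u v \<le> vlen u"
  unfolding meet_len_def by (intro SUP_least) (auto intro: prefix_of_len)

lemma enat_le_iff_all: "(a::enat) \<le> b \<longleftrightarrow> (\<forall>k. enat k \<le> a \<longrightarrow> enat k \<le> b)"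
proof (cases b)
  case (enat n)
  show ?thesis
  proof (safe)
    fix k assume "a \<le> b" "enat k \<le> a" then show "enat k \<le> b" by (rule order.trans[rotated])
  next
    assume A: "\<forall>k. enat k \<le> a \<longrightarrow> enat k \<le> b"
    show "a \<le> b"
    proof (rule ccontr)
      assume "\<not> a \<le> b"
      then have "enat (Suc n) \<le> a" using enat by (simp add: Suc_ile_eq not_le)
      with A have "enat (Suc n) \<le> b" by blast
      then show False using enat by simp
    qed
  qed
qed auto

lemma prefix_of_vlen: "enat k \<le> vlen u \<Longrightarrow> \<exists>w. length w = k \<and> prefix_of w u"
proof (cases u)
  case (Node x)
  assume "enat k \<le> vlen u"
  then show ?thesis using Node by (intro exI[of _ "take k x"]) (auto simp: take_is_prefix)
next
  case (End v)
  then show ?thesis by (intro exI[of _ "ray_prefix v k"]) auto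
qed

lemma meet_len_self: "meet_len u u = vlen u"
proof (rule antisym[OF meet_len_le])
  show "vlen u \<le> meet_len u u"
    by (subst enat_le_iff_all) (auto simp: le_meet_len dest: prefix_of_vlen)
qed

lemma meet_len_min: "min (meet_len u v) (meet_len v w) \<le> meet_len u w"
  by (subst enat_le_iff_all) (auto simp: le_meet_len dest: prefix_of_unique)

lemma meet_len_eqD:
  assumes "meet_len u v = vlen u" "meet_len u v = vlen v"
  shows "u = v"
proof (cases u)
  case (Node x)
  then have "enat (length x) \<le> meet_len u v" using assms by simp
  then obtain w where w: "length w = length x" "prefix_of w u" "prefix_of w v"
    by (auto simp: le_meet_len)
  have "vlen v = enat (length x)" using assms Node by simp
  then obtain y where y: "v = Node y" "length y = length x" by (cases v) auto
  have "w = x" "w = y" using w Node y by (auto simp: prefix_def)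
  then show ?thesis using Node y by simp
next
  case (End x)
  have inf: "vlen v = \<infinity>" using assms End by simp
  then obtain y where y: "v = End y" by (cases v) auto
  have "x k = y k" for k
  proof -
    have "enat (Suc k) \<le> meet_len u v" using assms End by simp
    then obtain w where w: "length w = Suc k" "prefix_of w u" "prefix_of w v"
      by (auto simp: le_meet_len)
    then have "ray_prefix x (Suc k) = ray_prefix y (Suc k)"
      using End y by (metis prefix_of.simps(2))
    then have "ray_prefix x (Suc k) ! k = ray_prefix y (Suc k) ! k" by simp
    then show "x k = y k" unfolding ray_prefix_def by (simp del: upt_Suc)
  qed
  then show ?thesis using End y by auto
qed

text \<open>
  The metric \<open>d\<^sub>\<bbbV>(u,v) = 2\<^bsup>-|u\<and>v|\<^esup> - (2\<^bsup>-|u|\<^esup> + 2\<^bsup>-|v|\<^esup>)/2\<close>, extended to rays with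
  \<open>2\<^bsup>-\<infinity>\<^esup> = 0\<close>.
\<close>

instantiation vbar :: metric_space
begin

definition dist_vbar :: "vbar \<Rightarrow> vbar \<Rightarrow> real" where
  "dist_vbar u v = half_pow (meet_len u v) - (half_pow (vlen u) + half_pow (vlen v)) / 2"

definition uniformity_vbar :: "(vbar \<times> vbar) filter" where
  "uniformity_vbar = (INF e\<in>{0<..}. principal {(x, y). dist x y < e})"

definition open_vbar :: "vbar set \<Rightarrow> bool" where
  "open_vbar U \<longleftrightarrow> (\<forall>x\<in>U. eventually (\<lambda>(x', y). x' = x \<longrightarrow> y \<in> U) uniformity)"

instance
proof
  fix x y z :: vbar
  show "dist x y = 0 \<longleftrightarrow> x = y"
  proof
    assume 0: "dist x y = 0"
    have le: "meet_len x y \<le> vlen x" "meet_len x y \<le> vlen y"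
      using meet_len_le[of x y] meet_len_le[of y x] by (auto simp: meet_len_commute)
    have a: "half_pow (vlen x) \<le> half_pow (meet_len x y)" "half_pow (vlen y) \<le> half_pow (meet_len x y)"
      using le by (auto intro: half_pow_antimono)
    have "meet_len x y = vlen x"
      using le(1) 0 a half_pow_strict[of "meet_len x y" "vlen x"]
      by (cases "meet_len x y = vlen x") (auto simp: dist_vbar_def order_less_le)
    moreover have "meet_len x y = vlen y"
      using le(2) 0 a half_pow_strict[of "meet_len x y" "vlen y"]
      by (cases "meet_len x y = vlen y") (auto simp: dist_vbar_def order_less_le)
    ultimately show "x = y" by (rule meet_len_eqD)
  next
    assume "x = y" then show "dist x y = 0" by (simp add: dist_vbar_def meet_len_self)
  qed
  have "half_pow (meet_len x y) + half_pow (vlen z) \<le> half_pow (meet_len x z) + half_pow (meet_len y z)"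
  proof -
    have m: "min (meet_len x z) (meet_len y z) \<le> meet_len x y"
      using meet_len_min[of x z y] by (simp add: meet_len_commute)
    have z: "half_pow (vlen z) \<le> half_pow (meet_len x z)" "half_pow (vlen z) \<le> half_pow (meet_len y z)"
      by (metis half_pow_antimono meet_len_le meet_len_commute)+
    show ?thesis
    proof (cases "meet_len x z \<le> meet_len y z")
      case True
      then have "half_pow (meet_len x y) \<le> half_pow (meet_len x z)"
        using m by (intro half_pow_antimono) (simp add: min_def)
      then show ?thesis using z by linarith
    next
      case False
      then have "half_pow (meet_len x y) \<le> half_pow (meet_len y z)"
        using m by (intro half_pow_antimono) (simp add: min_def)
      then show ?thesis using z by linarith
    qed
  qed
  then show "dist x y \<le> dist x z + dist y z"
    unfolding dist_vbar_def by (simp add: field_simps)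
qed (simp_all add: uniformity_vbar_def open_vbar_def)

end

lemma dist_End: "dist (End u) (End v) = half_pow (meet_len (End u) (End v))"
  by (simp add: dist_vbar_def)

text \<open>
  The type \<^typ>\<open>ray\<close> carries the product topology of the library. The next lemma says that this is
  the topology of the metric \<^term>\<open>\<lambda>u v. dist (End u) (End v)\<close>, so that
  \<^term>\<open>borel :: ray measure\<close> is the Borel algebra of the boundary. (The library's own \<^term>\<open>dist\<close>
  on functions is a different metric; it is not used.)
\<close>

definition cyl :: "node \<Rightarrow> ray set" where
  "cyl u = {v. prefix_of u (End v)}"

lemma mem_cyl: "v \<in> cyl (ray_prefix w k) \<longleftrightarrow> (\<forall>i<k. v i = w i)"
  by (auto simp: cyl_def ray_prefix_def)

lemma dist_End_less: "dist (End u) (End v) < (1 / 2) ^ k \<longleftrightarrow> v \<in> cyl (ray_prefix u (Suc k))"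
proof -
  have "v \<in> cyl (ray_prefix u (Suc k)) \<longleftrightarrow> enat (Suc k) \<le> meet_len (End u) (End v)"
    unfolding le_meet_len cyl_def by (simp, metis length_ray_prefix)
  also have "\<dots> \<longleftrightarrow> enat k < meet_len (End u) (End v)"
    by (simp add: Suc_ile_eq)
  also have "\<dots> \<longleftrightarrow> dist (End u) (End v) < (1 / 2) ^ k"
    unfolding dist_End by (cases "meet_len (End u) (End v)") (auto simp: power_strict_decreasing_iff)
  finally show ?thesis by simp
qed

lemma open_cyl: "open (cyl (ray_prefix w k))"
proof -
  have "cyl (ray_prefix w k) = Pi\<^sub>E UNIV (\<lambda>i. if i < k then {w i} else UNIV)"
    unfolding set_eq_iff mem_cyl PiE_iff by simp
  also have "open \<dots>"
    by (rule open_PiE) (auto intro: Topological_Spaces.open_discrete finite_subset[of _ "{..<k}"])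
  finally show ?thesis .
qed

lemma open_ray_iff: "open (U :: ray set) \<longleftrightarrow> (\<exists>W. open W \<and> U = End -` W)"
proof
  assume U: "open U"
  have "\<exists>e>0. \<forall>v. dist (End u) (End v) < e \<longrightarrow> v \<in> U" if u: "u \<in> U" for u
  proof -
    have "openin (product_topology (\<lambda>_. euclidean) UNIV) U" using U by (simp add: open_fun_def)
    from product_topology_open_contains_basis[OF this u]
    have "\<exists>A. u \<in> Pi\<^sub>E UNIV A \<and> (\<forall>i. open (A i)) \<and> finite {i. A i \<noteq> UNIV} \<and> Pi\<^sub>E UNIV A \<subseteq> U"
      by simp
    then obtain A where A: "u \<in> Pi\<^sub>E UNIV A" "finite {i. A i \<noteq> UNIV}" "Pi\<^sub>E UNIV A \<subseteq> U"
      by (elim exE conjE) (rule that)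
    have "\<exists>k. \<forall>i. A i \<noteq> UNIV \<longrightarrow> i < k"
      using A(2) unfolding finite_nat_set_iff_bounded by simp
    then obtain k where k: "\<forall>i. A i \<noteq> UNIV \<longrightarrow> i < k"
      by (elim exE) (rule that)
    have "v \<in> U" if "dist (End u) (End v) < (1 / 2) ^ k" for v
    proof -
      have eq: "\<forall>i<Suc k. v i = u i" using that unfolding dist_End_less mem_cyl .
      have "v i \<in> A i" for i
      proof (cases "A i = UNIV")
        case False
        then have "i < Suc k" using k by (blast intro: less_SucI)
        then have "v i = u i" using eq by blast
        then show ?thesis using A(1) by (simp add: PiE_iff)
      qed simp
      then have "v \<in> Pi\<^sub>E UNIV A" by (simp add: PiE_iff)
      then show ?thesis using A(3) by (rule rev_subsetD)
    qed
    then show ?thesis by (intro exI[of _ "(1 / 2) ^ k"]) auto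
  qed
  then obtain e where e: "\<And>u. u \<in> U \<Longrightarrow> e u > 0" "\<And>u v. u \<in> U \<Longrightarrow> dist (End u) (End v) < e u \<Longrightarrow> v \<in> U"
    by metis
  show "\<exists>W. open W \<and> U = End -` W"
    by (rule exI[of _ "\<Union>u\<in>U. ball (End u) (e u)"]) (use e in \<open>auto, metis dist_self\<close>)
next
  assume "\<exists>W. open W \<and> U = End -` W"
  then obtain W where W: "open W" "U = End -` W" by blast
  show "open U"
  proof (rule iffD2[OF open_subopen], rule ballI)
    fix u assume "u \<in> U"
    then obtain e where e: "e > 0" "\<And>y. dist y (End u) < e \<Longrightarrow> y \<in> W"
      using W by (auto simp: open_dist)
    obtain k where k: "(1 / 2 :: real) ^ k < e"
      using e(1) real_arch_pow_inv[of e "1/2"] by auto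
    have "cyl (ray_prefix u (Suc k)) \<subseteq> U"
    proof
      fix v assume "v \<in> cyl (ray_prefix u (Suc k))"
      then have "dist (End u) (End v) < e" using k by (metis dist_End_less less_trans)
      then show "v \<in> U" using e(2) W(2) by (auto simp: dist_commute)
    qed
    then show "\<exists>T. open T \<and> u \<in> T \<and> T \<subseteq> U"
      by (intro exI[of _ "cyl (ray_prefix u (Suc k))"]) (auto simp: open_cyl mem_cyl)
  qed
qed

lemma continuous_on_End: "continuous_on UNIV End"
  by (simp add: continuous_on_open_vimage) (blast intro: open_ray_iff[THEN iffD2])

lemma measurable_End [measurable]: "End \<in> borel_measurable borel"
  by (rule borel_measurable_continuous_onI) (rule continuous_on_End)

text \<open>Nodes are dense, so \<^typ>\<open>vbar\<close> lies in the completion of the set of nodes.\<close>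

lemma Node_tendsto_End: "(\<lambda>k. Node (ray_prefix v k)) \<longlonglongrightarrow> End v"
proof -
  have m: "meet_len (Node (ray_prefix v k)) (End v) = enat k" for k
  proof (rule antisym)
    show "meet_len (Node (ray_prefix v k)) (End v) \<le> enat k"
      using meet_len_le[of "Node (ray_prefix v k)" "End v"] by simp
    show "enat k \<le> meet_len (Node (ray_prefix v k)) (End v)"
      unfolding le_meet_len by (rule exI[of _ "ray_prefix v k"]) simp
  qed
  have d: "dist (Node (ray_prefix v k)) (End v) = (1 / 2) ^ k / 2" for k
    by (simp add: dist_vbar_def m)
  have "(\<lambda>k. (1 / 2 :: real) ^ k / 2) \<longlonglongrightarrow> 0 / 2"
    by (intro tendsto_intros LIMSEQ_power_zero) auto
  then show ?thesis by (subst tendsto_dist_iff) (simp add: d)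
qed

lemma closure_Node: "closure (range Node) = UNIV"
proof -
  have "x \<in> closure (range Node)" for x
  proof (cases x)
    case (Node u)
    then show ?thesis using closure_subset[of "range Node"] by blast
  next
    case (End v)
    show ?thesis unfolding closure_sequential
      by (rule exI[of _ "\<lambda>k. Node (ray_prefix v k)"]) (use Node_tendsto_End End in simp)
  qed
  then show ?thesis by blast
qed

definition hoelder :: "real \<Rightarrow> (ray \<Rightarrow> real) \<Rightarrow> bool" where
  "hoelder \<alpha> h \<longleftrightarrow> (\<exists>C. \<forall>u v. u \<noteq> v \<longrightarrow> \<bar>h u - h v\<bar> \<le> C * dist (End u) (End v) powr \<alpha>)"

definition sup_norm :: "(ray \<Rightarrow> ereal) \<Rightarrow> ennreal" where
  "sup_norm h = (SUP v. e2ennreal \<bar>h v\<bar>)"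


section \<open>Binary trees\<close>

definition binary_tree :: "node set \<Rightarrow> bool" where
  "binary_tree x \<longleftrightarrow> (\<forall>u\<in>x. \<forall>v. prefix v u \<longrightarrow> v \<in> x)"

definition external :: "node set \<Rightarrow> node set" where
  "external x = {u. u \<noteq> [] \<and> butlast u \<in> x \<and> u \<notin> x}"

definition subtree_size :: "node set \<Rightarrow> node \<Rightarrow> nat" where
  "subtree_size x u = card {v \<in> x. prefix u v}"

text \<open>For finite \<open>x\<close> only finitely many terms are nonzero.\<close>

definition metric_silhouette :: "node set \<Rightarrow> ray \<Rightarrow> real" where
  "metric_silhouette x v = (\<Sum>k. real (subtree_size x (ray_prefix v (Suc k))))"


section \<open>The BST chain and its limit\<close>

definition bst_step :: "node set \<Rightarrow> node set pmf" where
  "bst_step x = map_pmf (\<lambda>u. insert u x) (pmf_of_set (external x))"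

text \<open>Time starts at 1; \<open>X 0\<close> is irrelevant.\<close>

definition bst_chain :: "'w measure \<Rightarrow> (nat \<Rightarrow> 'w \<Rightarrow> node set) \<Rightarrow> bool" where
  "bst_chain M X \<longleftrightarrow>
     (\<forall>n\<ge>1. X n \<in> measurable M (count_space {x. finite x \<and> binary_tree x})) \<and>
     (AE \<omega> in M. X 1 \<omega> = {[]}) \<and>
     (\<forall>n\<ge>1. \<forall>x y. \<P>(\<omega> in M. \<forall>i\<in>{1..n}. X i \<omega> = x i) > 0 \<longrightarrow>
        \<P>(\<omega> in M. X (Suc n) \<omega> = y \<bar> \<forall>i\<in>{1..n}. X i \<omega> = x i) = pmf (bst_step (x n)) y)"

definition weakly_converges :: "(nat \<Rightarrow> 'a::metric_space measure) \<Rightarrow> 'a measure \<Rightarrow> bool" where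
  "weakly_converges \<mu> \<nu> \<longleftrightarrow>
     (\<forall>f :: 'a \<Rightarrow> real. continuous_on UNIV f \<and> bounded (range f) \<longrightarrow>
        (\<lambda>n. \<integral>x. f x \<partial>\<mu> n) \<longlonglongrightarrow> (\<integral>x. f x \<partial>\<nu>))"

text \<open>Both sides are pushed forward to the completion.\<close>

definition bst_limit :: "'w measure \<Rightarrow> (nat \<Rightarrow> 'w \<Rightarrow> node set) \<Rightarrow> ('w \<Rightarrow> ray measure) \<Rightarrow> bool" where
  "bst_limit M X Xinf \<longleftrightarrow>
     Xinf \<in> measurable M (prob_algebra borel) \<and>
     (AE \<omega> in M. weakly_converges
        (\<lambda>n. distr (measure_pmf (pmf_of_set (X n \<omega>))) borel Node)
        (distr (Xinf \<omega>) borel End))"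

text \<open>\<open>-log\<^sub>2\<close> on \<open>[0,1]\<close>, where distances of rays lie; the library has \<^term>\<open>log 2 0 = 0\<close>.\<close>

definition neg_log2 :: "real \<Rightarrow> ennreal" where
  "neg_log2 t = (if t = 0 then \<infinity> else ennreal (- log 2 t))"

definition Sigma_inf :: "ray measure \<Rightarrow> ray \<Rightarrow> ereal" where
  "Sigma_inf \<mu> v = enn2ereal (\<integral>\<^sup>+u. neg_log2 (dist (End u) (End v)) \<partial>\<mu>)"


section \<open>The constants\<close>

definition rho0 :: real where
  "rho0 = (LEAST \<rho>. \<rho> > 0 \<and> 2 * exp 1 * ln \<rho> = \<rho>)"

definition alpha0 :: real where
  "alpha0 = log 2 rho0"

text \<open>The defining equation has exactly two roots, and the numerical values are as expected.\<close>

lemma rho_crit: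
  assumes "0 < x" "x < y" "2 * exp 1 * ln x = x" "2 * exp 1 * ln y = y"
  shows "x < 2 * exp (1::real) \<and> 2 * exp 1 < y"
proof -
  have "\<exists>z>x. z < y \<and> ((2 * exp 1 * ln y - y) - (2 * exp 1 * ln x - x)) = (y - x) * (2 * exp 1 / z - 1)"
    by (rule MVT2) (use assms in \<open>auto intro!: derivative_eq_intros\<close>)
  then obtain z where z: "z > x" "z < y" "(y - x) * (2 * exp 1 / z - 1) = 0"
    using assms by auto
  then have "2 * exp 1 / z = 1" using assms by auto
  then have "z = 2 * exp 1" using z assms by simp
  then show ?thesis using z by simp
qed

lemma rho_IVT:
  fixes a b :: real
  assumes "0 < a" "a \<le> b" "(2 * exp 1 * ln a - a) * (2 * exp 1 * ln b - b) < 0"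
  shows "\<exists>x. a < x \<and> x < b \<and> 2 * exp 1 * ln x = x"
proof -
  define g where "g = (\<lambda>x::real. 2 * exp 1 * ln x - x)"
  have c: "continuous_on {a..b} g" unfolding g_def
    by (intro continuous_intros) (use assms in auto)
  have ne: "g a * g b < 0" using assms by (simp add: g_def)
  then have "g a < 0 \<and> 0 < g b \<or> 0 < g a \<and> g b < 0" by (simp add: mult_less_0_iff) argo
  then have "\<exists>x. a \<le> x \<and> x \<le> b \<and> g x = 0"
    using IVT'[of g a 0 b] IVT2'[of g b 0 a] c assms by force
  then obtain x where x: "a \<le> x" "x \<le> b" "g x = 0" by blast
  then have "x \<noteq> a" "x \<noteq> b" using ne by auto
  then show ?thesis using x by (intro exI[of _ x]) (auto simp: g_def)
qed

lemma exp_1_bounds: "(2.718281828::real) < exp 1" "exp 1 < (2.718281829::real)"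
  using e_approx_32 by (auto simp: abs_if split: if_splits)

lemma
  shows rho0_root: "2 * exp 1 * ln rho0 = rho0"
    and rho0_bounds: "1.26107 < rho0" "rho0 < 1.261071"
    and rho0_smaller_of_two:
      "\<exists>\<rho>\<^sub>1>rho0. {\<rho>. \<rho> > 0 \<and> 2 * exp 1 * ln \<rho> = \<rho>} = {rho0, \<rho>\<^sub>1}"
proof -
  have l1: "ln (1.26107::real) < 0.2319607" and l2: "ln (1.261071::real) > 0.2319612"
    using ln_approx_bounds[of "1.26107" 4] ln_approx_bounds[of "1.261071" 4]
    by (simp_all add: eval_nat_numeral)
  have "2 * exp 1 * ln (1.26107::real) \<le> 2 * 2.718281829 * 0.2319607"
    by (intro mult_mono) (use l1 exp_1_bounds in auto)
  then have g1: "2 * exp 1 * ln (1.26107::real) < 1.26107" by simp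
  have "2 * 2.718281828 * 0.2319612 \<le> 2 * exp 1 * ln (1.261071::real)"
    by (intro mult_mono) (use l2 exp_1_bounds in auto)
  then have g2: "2 * exp 1 * ln (1.261071::real) > 1.261071" by simp
  obtain r :: real where r: "1.26107 < r" "r < 1.261071" "2 * exp 1 * ln r = r"
    using rho_IVT[of "1.26107" "1.261071"] g1 g2 by (auto simp: mult_less_0_iff)
  have r2: "r \<le> y" if "y > 0" "2 * exp 1 * ln y = y" for y :: real
  proof (rule ccontr)
    assume "\<not> r \<le> y"
    then show False using rho_crit[of y r] that r exp_1_bounds by simp
  qed
  have eq: "rho0 = r"
    unfolding rho0_def by (rule Least_equality) (use r r2 in auto)
  show "2 * exp 1 * ln rho0 = rho0" "1.26107 < rho0" "rho0 < 1.261071"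
    using r by (simp_all add: eq)
  have e2: "exp (2::real) = exp 1 * exp 1" "exp (3::real) = exp 1 * exp 1 * exp 1"
    by (simp_all add: exp_add[symmetric])
  have "exp 1 * (4 - exp 1) > (0::real)"
    using exp_1_bounds by simp
  then have p: "2 * exp 1 * ln (exp 2) - exp (2::real) > 0"
    unfolding ln_exp unfolding e2 by (simp add: algebra_simps)
  have "2.7 * 2.7 \<le> exp 1 * exp (1::real)"
    by (intro mult_mono) (use exp_1_bounds in auto)
  then have "exp 1 * (6 - exp 1 * exp 1) < (0::real)" by (simp add: mult_less_0_iff)
  then have q: "2 * exp 1 * ln (exp 3) - exp (3::real) < 0"
    unfolding ln_exp unfolding e2 by (simp add: algebra_simps)
  obtain s :: real where s: "exp 2 < s" "2 * exp 1 * ln s = s"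
    using rho_IVT[of "exp 2" "exp 3"] p q by (auto simp: mult_less_0_iff)
  have "r < exp 2" using r exp_ge_add_one_self[of "2::real"] by simp
  then have rs: "r < s" using s by linarith
  have "y = r \<or> y = s" if "y > 0" "2 * exp 1 * ln y = y" for y :: real
    using rho_crit[of r y] rho_crit[of y s] rho_crit[of s y] rho_crit[of r s] r2[OF that] rs that r s
    by (cases y s rule: linorder_cases) force+
  then have "{\<rho>. \<rho> > 0 \<and> 2 * exp 1 * ln \<rho> = \<rho>} = {r, s}"
    using r s rs by auto
  then show "\<exists>\<rho>\<^sub>1>rho0. {\<rho>. \<rho> > 0 \<and> 2 * exp 1 * ln \<rho> = \<rho>} = {rho0, \<rho>\<^sub>1}"
    using rs eq by blast
qed

lemma alpha0_bounds: "0.33464 < alpha0" "alpha0 < 0.33465"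
proof -
  have l2: "0.69314718 < ln (2::real)" "ln (2::real) < 0.69314719"
    using ln_approx_bounds[of 2 9] by (simp_all add: eval_nat_numeral)
  have l1: "0.231960 < ln (1.26107::real)" and l3: "ln (1.261071::real) < 0.2319614"
    using ln_approx_bounds[of "1.26107" 4] ln_approx_bounds[of "1.261071" 4]
    by (simp_all add: eval_nat_numeral)
  have "ln (1.26107::real) < ln rho0" "ln rho0 < ln (1.261071::real)"
    using rho0_bounds by simp_all
  then have "0.231960 < ln rho0" "ln rho0 < 0.2319614" using l1 l3 by linarith+
  then show "0.33464 < alpha0" "alpha0 < 0.33465"
    using l2 unfolding alpha0_def log_def by (simp_all add: field_simps)
qed

end

theory Submission
  imports Defs
begin

text \<open>
  Writing \<open>-log\<^sub>2 d(u,v) = |u \<and> v|\<close> as a count of common prefixes gives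
  \<open>\<Sigma>\<^sub>\<infinity>(v) = \<Sum>\<^sub>k X\<^sub>\<infinity>(A\<^bsub>v(k)\<^esub>)\<close>, so all three parts follow from a bound for
  \<open>Y\<^sub>k = sup\<^sub>n max {\<sigma>(X\<^sub>n,u)/n : |u| = k}\<close>, which dominates both \<open>\<sigma>(X\<^sub>n,u)/n\<close> and its limit
  \<open>X\<^sub>\<infinity>(A\<^sub>u)\<close>. For \<open>\<theta> > 0\<close>, the conditional expectation of \<open>\<Sum>\<^bsub>|u| = k\<^esub> X\<^sub>\<infinity>(A\<^sub>u)\<^sup>\<theta>\<close> given
  \<open>X\<^sub>n\<close> is an explicit function of the tree, defined by recursion on \<open>k\<close>. It is a nonnegative martingale
  with mean \<open>(2/(1+\<theta>))\<^sup>k\<close>, and it bounds \<open>(\<sigma>(X\<^sub>n,u)/n)\<^sup>\<theta>\<close> from above. The maximal inequality gives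
  \<open>P(Y\<^sub>k > t) \<le> (2/(1+\<theta>))\<^sup>k / t\<^sup>\<theta>\<close>; for the best \<open>\<theta>\<close> the right-hand side is
  \<open>(t \<rho>\<^sub>0\<^sup>k)\<^sup>-\<^sup>\<theta>\<close>. Hence \<open>E(\<Sum>\<^sub>k Y\<^sub>k) < \<infinity>\<close>, and by Borel--Cantelli almost surely
  \<open>Y\<^sub>k = O(c\<^sup>-\<^sup>k)\<close> for every \<open>c < \<rho>\<^sub>0\<close>; dominated convergence does the rest.
\<close>

section \<open>Binary trees and the potential\<close>

definition branch :: "bool \<Rightarrow> node set \<Rightarrow> node set" where
  "branch b x = {u. b # u \<in> x}"

text \<open>In contrast to \<open>external\<close>, the empty tree gets the frontier
  \<open>{[]}\<close>. Recursion over the two branches, which may be empty, then needs no special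
  case.\<close>

definition frontier_nodes :: "node set \<Rightarrow> node set" where
  "frontier_nodes x = {u. u \<notin> x \<and> (u \<noteq> [] \<longrightarrow> butlast u \<in> x)}"

lemma frontier_nodes_eq_external: "[] \<in> x \<Longrightarrow> frontier_nodes x = external x"
  by (auto simp: frontier_nodes_def external_def)

lemma frontier_nodes_empty [simp]: "frontier_nodes {} = {[]}"
  by (auto simp: frontier_nodes_def)

lemma binary_tree_root: "binary_tree x \<Longrightarrow> x \<noteq> {} \<Longrightarrow> [] \<in> x"
  by (auto simp: binary_tree_def)

lemma mem_branch: "u \<in> branch b x \<longleftrightarrow> b # u \<in> x"
  by (simp add: branch_def)

lemma branch_empty [simp]: "branch b {} = {}"
  by (simp add: branch_def)

lemma branch_insert_Cons: "branch b (insert (c # w) x) = (if b = c then insert w (branch b x) else branch b x)"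
  by (auto simp: branch_def)

lemma finite_branch [simp]: "finite x \<Longrightarrow> finite (branch b x)"
  unfolding branch_def using finite_vimageI[of x "Cons b"] by (simp add: vimage_def)

lemma binary_tree_branch [simp]: "binary_tree x \<Longrightarrow> binary_tree (branch b x)"
  unfolding binary_tree_def branch_def by (metis Cons_prefix_Cons mem_Collect_eq)

lemma binary_tree_insert_external:
  assumes "binary_tree x" "u \<in> external x" shows "binary_tree (insert u x)"
proof -
  have u: "u \<noteq> []" "butlast u \<in> x" using assms(2) by (auto simp: external_def)
  have "v \<in> insert u x" if "prefix v u" for v
  proof (cases "v = u")
    case False
    then have "prefix v (butlast u)"
      using that u prefix_snoc[of v "butlast u" "last u"] by simp
    then show ?thesis using assms(1) u(2) unfolding binary_tree_def by blast
  qed simp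
  then show ?thesis using assms(1) unfolding binary_tree_def by blast
qed

lemma tree_decomp:
  assumes "[] \<in> x"
  shows "x = insert [] (Cons False ` branch False x \<union> Cons True ` branch True x)"
proof (rule set_eqI)
  fix u
  show "u \<in> x \<longleftrightarrow> u \<in> insert [] (Cons False ` branch False x \<union> Cons True ` branch True x)"
  proof (cases u)
    case (Cons b w)
    then show ?thesis by (cases b) (auto simp: branch_def)
  qed (use assms in simp)
qed

lemma card_tree:
  assumes "finite x" "[] \<in> x"
  shows "card x = Suc (card (branch False x) + card (branch True x))"
proof -
  have "card x = Suc (card (Cons False ` branch False x \<union> Cons True ` branch True x))"
    by (subst tree_decomp[OF assms(2)], subst card_insert_disjoint) (use assms in auto)
  also have "card (Cons False ` branch False x \<union> Cons True ` branch True x) =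
      card (branch False x) + card (branch True x)"
    by (subst card_Un_disjoint) (use assms in \<open>auto simp: card_image\<close>)
  finally show ?thesis .
qed

lemma frontier_nodes_decomp:
  assumes "[] \<in> x"
  shows "frontier_nodes x = Cons False ` frontier_nodes (branch False x) \<union> Cons True ` frontier_nodes (branch True x)"
proof (rule set_eqI)
  fix u
  show "u \<in> frontier_nodes x \<longleftrightarrow>
      u \<in> Cons False ` frontier_nodes (branch False x) \<union> Cons True ` frontier_nodes (branch True x)"
  proof (cases u)
    case (Cons b w)
    then show ?thesis using assms
      by (cases b) (auto simp: frontier_nodes_def branch_def image_iff)
  qed (use assms in \<open>auto simp: frontier_nodes_def\<close>)
qed

lemma sum_frontier_nodes:
  fixes g :: "node \<Rightarrow> 'a::comm_monoid_add"
  assumes "[] \<in> x" and "\<And>b. finite (frontier_nodes (branch b x))"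
  shows "sum g (frontier_nodes x) =
    (\<Sum>w\<in>frontier_nodes (branch False x). g (False # w)) + (\<Sum>w\<in>frontier_nodes (branch True x). g (True # w))"
  unfolding frontier_nodes_decomp[OF assms(1)]
  by (subst sum.union_disjoint) (use assms in \<open>auto simp: sum.reindex\<close>)

text \<open>Splitting at the root, branches with a and b nodes have (a + 1) + (b + 1) frontier nodes
  together, against 1 + a + b nodes of the tree.\<close>

lemma finite_card_frontier_nodes:
  assumes "finite x" "binary_tree x"
  shows "finite (frontier_nodes x) \<and> card (frontier_nodes x) = Suc (card x)"
  using assms
proof (induction "card x" arbitrary: x rule: less_induct)
  case less
  show ?case
  proof (cases "x = {}")
    case False
    then have r: "[] \<in> x" using less.prems by (simp add: binary_tree_root)
    have c: "card x = Suc (card (branch False x) + card (branch True x))"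
      using less.prems r by (intro card_tree)
    have "card (branch b x) < card x" for b
      using c by (cases b) auto
    then have IH: "finite (frontier_nodes (branch b x)) \<and> card (frontier_nodes (branch b x)) = Suc (card (branch b x))" for b
      by (rule less.hyps) (use less.prems in auto)
    then have "finite (frontier_nodes x)" by (simp add: frontier_nodes_decomp[OF r])
    moreover have "card (frontier_nodes x) = Suc (card x)"
      using sum_frontier_nodes[OF r, of "\<lambda>_. 1::nat"] IH c by simp
    ultimately show ?thesis by simp
  qed simp
qed

text \<open>This is Gamma(m+1+\<theta>) / (Gamma(1+\<theta>) m!). For m < n the quotient
  \<open>growth \<theta> m / growth \<theta> n\<close> is the \<theta>-th moment of the Beta(m+1,
  n-m) law, the conditional law of the limiting mass of a nonempty subtree with m of the n
  nodes.\<close>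

definition growth :: "real \<Rightarrow> nat \<Rightarrow> real" where
  "growth \<theta> m = (\<Prod>i=1..m. 1 + \<theta> / real i)"

lemma growth_0 [simp]: "growth \<theta> 0 = 1"
  by (simp add: growth_def)

lemma growth_Suc: "growth \<theta> (Suc m) = growth \<theta> m * (1 + \<theta> / real (Suc m))"
  by (simp add: growth_def)

lemma growth_pos: "\<theta> \<ge> 0 \<Longrightarrow> growth \<theta> m > 0"
  unfolding growth_def by (intro prod_pos) (auto intro: add_pos_nonneg)

text \<open>Induction on n: one step uses (n/(n+1))^\<theta> \<le> exp(-\<theta>/(n+1)) \<le>
  1/(1+\<theta>/(n+1)), which follows from ln x \<le> x - 1 and 1 + x \<le> exp x.\<close>

lemma growth_ratio:
  assumes "\<theta> \<ge> 0" "1 \<le> m" "m \<le> n"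
  shows "(real m / real n) powr \<theta> \<le> growth \<theta> m / growth \<theta> n"
  using assms(3)
proof (induction n rule: dec_induct)
  case base
  then show ?case using assms growth_pos[of \<theta> m] by simp
next
  case (step n)
  have n: "n \<ge> 1" using step assms by simp
  have "ln (real n / real (Suc n)) \<le> real n / real (Suc n) - 1"
    using n by (intro ln_le_minus_one) auto
  also have "\<dots> = - 1 / real (Suc n)" by (simp add: field_simps)
  finally have "\<theta> * ln (real n / real (Suc n)) \<le> \<theta> * (- 1 / real (Suc n))"
    using assms by (intro mult_left_mono)
  then have "(real n / real (Suc n)) powr \<theta> \<le> exp (- (\<theta> / real (Suc n)))"
    using n by (simp add: powr_def)
  also have "\<dots> = 1 / exp (\<theta> / real (Suc n))" by (simp add: exp_minus field_simps)
  also have "\<dots> \<le> 1 / (1 + \<theta> / real (Suc n))"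
    using assms by (intro divide_left_mono exp_ge_add_one_self mult_pos_pos add_pos_nonneg) auto
  finally have s: "(real n / real (Suc n)) powr \<theta> \<le> 1 / (1 + \<theta> / real (Suc n))" .
  have "(real m / real (Suc n)) powr \<theta> = (real m / real n) powr \<theta> * (real n / real (Suc n)) powr \<theta>"
    using n by (simp flip: powr_mult)
  also have "\<dots> \<le> (growth \<theta> m / growth \<theta> n) * (1 / (1 + \<theta> / real (Suc n)))"
    using s step.IH growth_pos[OF assms(1)] by (intro mult_mono) (auto simp: less_imp_le)
  finally show ?case by (simp add: growth_Suc)
qed

text \<open>
  For a tree \<open>x\<close> with \<open>n\<close> nodes, \<open>potential \<theta> k x / growth \<theta> n\<close> is the conditional expectation, given
  that the chain visits \<open>x\<close>, of the sum over the nodes at level \<open>k\<close> of the \<open>\<theta>\<close>-th power of the limiting mass.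
\<close>

fun potential :: "real \<Rightarrow> nat \<Rightarrow> node set \<Rightarrow> real" where
  "potential \<theta> 0 x = growth \<theta> (card x)"
| "potential \<theta> (Suc k) x = (if x = {} then (2 / (1 + \<theta>)) ^ Suc k
     else potential \<theta> k (branch False x) + potential \<theta> k (branch True x))"

text \<open>Below a node not yet inserted, mass splits by independent uniform variables U. The two
  parts contribute E(U^\<theta>) = 1/(1+\<theta>) each, hence the factor 2/(1+\<theta>) per
  level.\<close>

lemma potential_empty: "potential \<theta> k {} = (2 / (1 + \<theta>)) ^ k"
  by (cases k) auto

lemma potential_nonneg: "\<theta> \<ge> 0 \<Longrightarrow> potential \<theta> k x \<ge> 0"
  by (induction k arbitrary: x) (auto simp: less_imp_le growth_pos)

text \<open>This is the martingale property before normalisation. An insertion alters only one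
  branch: for branches with a and b nodes, the first summand picks up a + 1 + \<theta> from
  insertions on its own side and b + 1 from those on the other side, which leave it unchanged. The
  factor is a + b + 2 + \<theta> for both summands.\<close>

lemma sum_potential:
  assumes "\<theta> \<ge> 0" "finite x" "binary_tree x"
  shows "(\<Sum>w\<in>frontier_nodes x. potential \<theta> k (insert w x)) = (real (card x) + 1 + \<theta>) * potential \<theta> k x"
  using assms(2,3)
proof (induction k arbitrary: x)
  case 0
  have "potential \<theta> 0 (insert w x) = growth \<theta> (Suc (card x))" if "w \<in> frontier_nodes x" for w
    using that 0 by (simp add: frontier_nodes_def)
  then have "(\<Sum>w\<in>frontier_nodes x. potential \<theta> 0 (insert w x)) = real (card (frontier_nodes x)) * growth \<theta> (Suc (card x))"
    by simp
  also have "\<dots> = (real (card x) + 1 + \<theta>) * growth \<theta> (card x)"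
    using finite_card_frontier_nodes[OF 0] by (simp add: growth_Suc field_simps)
  finally show ?case by simp
next
  case (Suc k)
  show ?case
  proof (cases "x = {}")
    case True
    have b: "branch b {[]} = {}" for b by (simp add: branch_def)
    define q where "q = 2 / (1 + \<theta>)"
    have "(1 + \<theta>) * q = 2" using assms(1) by (simp add: q_def field_simps)
    then have "(1 + \<theta>) * (q * q ^ k) = 2 * q ^ k" by (simp add: mult.assoc[symmetric])
    then show ?thesis using True by (simp add: potential_empty b flip: q_def)
  next
    case False
    then have r: "[] \<in> x" using Suc.prems by (simp add: binary_tree_root)
    let ?c = "\<lambda>b. real (card (branch b x))" and ?p = "\<lambda>b. potential \<theta> k (branch b x)"
    have fin: "finite (frontier_nodes (branch b x))" and
      card: "card (frontier_nodes (branch b x)) = Suc (card (branch b x))" for b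
      using finite_card_frontier_nodes[of "branch b x"] Suc.prems by auto
    have IH: "(\<Sum>w\<in>frontier_nodes (branch b x). potential \<theta> k (insert w (branch b x))) = (?c b + 1 + \<theta>) * ?p b" for b
      using Suc.prems by (intro Suc.IH) auto
    have "(\<Sum>w\<in>frontier_nodes x. potential \<theta> (Suc k) (insert w x)) =
      ((?c False + 1 + \<theta>) * ?p False + (?c False + 1) * ?p True) +
      ((?c True + 1) * ?p False + (?c True + 1 + \<theta>) * ?p True)"
      by (subst sum_frontier_nodes[OF r fin])
         (simp add: branch_insert_Cons sum.distrib IH card algebra_simps)
    also have "\<dots> = (real (card x) + 1 + \<theta>) * (?p False + ?p True)"
      using card_tree[OF Suc.prems(1) r] by (simp add: algebra_simps)
    finally show ?thesis using False by simp
  qed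
qed

section \<open>Subtree sizes bounded by the potential\<close>

lemma subtree_size_Nil: "subtree_size x [] = card x"
  by (simp add: subtree_size_def)

lemma subtree_size_Cons: "subtree_size x (b # u) = subtree_size (branch b x) u"
proof -
  have "{v \<in> x. prefix (b # u) v} = Cons b ` {v \<in> branch b x. prefix u v}"
    by (auto simp: branch_def prefix_def)
  then show ?thesis by (simp add: subtree_size_def card_image)
qed

text \<open>Along the path to u, one of two nonnegative summands is kept at each level. The path has
  to stay in x: at an empty branch the potential is a power of 2/(1+\<theta>), which may be less
  than \<open>growth \<theta> 0\<close>.\<close>

lemma growth_le_potential:
  assumes "\<theta> \<ge> 0" "finite x" "binary_tree x" "u \<in> x"
  shows "growth \<theta> (subtree_size x u) \<le> potential \<theta> (length u) x"
  using assms(2-)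
proof (induction u arbitrary: x)
  case (Cons b u)
  have "growth \<theta> (subtree_size x (b # u)) \<le> potential \<theta> (length u) (branch b x)"
    unfolding subtree_size_Cons using Cons.prems by (intro Cons.IH) (auto simp: mem_branch)
  also have "\<dots> \<le> potential \<theta> (length (b # u)) x"
    using Cons.prems assms(1) by (cases b) (auto simp: potential_nonneg)
  finally show ?case .
qed (simp add: subtree_size_Nil)

lemma subtree_size_eq_0:
  assumes "binary_tree x" "u \<notin> x" shows "subtree_size x u = 0"
proof -
  have "{v \<in> x. prefix u v} = {}" using assms by (auto simp: binary_tree_def)
  then show ?thesis by (simp only: subtree_size_def card.empty)
qed

lemma subtree_size_le_card: "finite x \<Longrightarrow> subtree_size x u \<le> card x"
  by (auto simp: subtree_size_def intro: card_mono)

text \<open>Inside the tree the subtree has at least one node, as \<open>growth_ratio\<close>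
  demands. Outside, the left side is \<open>0 powr \<theta>\<close>, which is 0 for every
  \<theta>.\<close>

lemma subtree_ratio_le_potential:
  assumes "\<theta> \<ge> 0" "finite x" "binary_tree x"
  shows "(real (subtree_size x u) / real (card x)) powr \<theta> \<le> potential \<theta> (length u) x / growth \<theta> (card x)"
proof (cases "u \<in> x")
  case True
  have "finite {v \<in> x. prefix u v}" "u \<in> {v \<in> x. prefix u v}" using True assms by auto
  then have "subtree_size x u \<ge> 1" unfolding subtree_size_def
    by (metis One_nat_def Suc_leI card_gt_0_iff empty_iff)
  then have "(real (subtree_size x u) / real (card x)) powr \<theta> \<le> growth \<theta> (subtree_size x u) / growth \<theta> (card x)"
    using assms by (intro growth_ratio subtree_size_le_card) auto
  also have "\<dots> \<le> potential \<theta> (length u) x / growth \<theta> (card x)"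
    using growth_le_potential[OF assms True] growth_pos[OF assms(1)] by (simp add: divide_right_mono less_imp_le)
  finally show ?thesis .
qed (use assms in \<open>simp add: subtree_size_eq_0 potential_nonneg growth_pos less_imp_le\<close>)

section \<open>The chain and the maximal inequality\<close>

abbreviation trees :: "node set set" where
  "trees \<equiv> {x. finite x \<and> binary_tree x}"

definition trees_of_card :: "nat \<Rightarrow> node set set" where
  "trees_of_card n = {x \<in> trees. card x = n}"

lemma countable_trees: "countable trees"
  by (rule countable_subset[of _ "{x. finite x}"]) (auto simp: countable_Collect_finite)

lemma trees_of_cardD:
  assumes "x \<in> trees_of_card n" "n \<ge> 1"
  shows "finite x" "binary_tree x" "card x = n" "[] \<in> x" "x \<noteq> {}" "finite (external x)"
    "card (external x) = Suc n" "external x \<noteq> {}"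
proof -
  show *: "finite x" "binary_tree x" "card x = n" using assms by (auto simp: trees_of_card_def)
  then show "x \<noteq> {}" using assms by auto
  then show r: "[] \<in> x" using * binary_tree_root by blast
  show "finite (external x)" "card (external x) = Suc n"
    using finite_card_frontier_nodes[OF *(1,2)] *(3) by (auto simp: frontier_nodes_eq_external[OF r])
  then show "external x \<noteq> {}" by auto
qed

lemma set_bst_step:
  assumes "x \<in> trees_of_card n" "n \<ge> 1"
  shows "set_pmf (bst_step x) \<subseteq> trees_of_card (Suc n)"
proof -
  note x = trees_of_cardD[OF assms]
  have "insert u x \<in> trees_of_card (Suc n)" if "u \<in> external x" for u
    using x that binary_tree_insert_external[OF x(2) that]
    by (auto simp: trees_of_card_def external_def)
  then show ?thesis using x by (auto simp: bst_step_def set_pmf_of_set)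
qed

lemma nn_integral_bst_step:
  assumes "x \<in> trees_of_card n" "n \<ge> 1"
  shows "(\<integral>\<^sup>+y. f y \<partial>bst_step x) = (\<Sum>u\<in>external x. f (insert u x)) / of_nat (Suc n)"
  using trees_of_cardD[OF assms]
  by (simp add: bst_step_def nn_integral_pmf_of_set)

definition norm_potential :: "real \<Rightarrow> nat \<Rightarrow> node set \<Rightarrow> real" where
  "norm_potential \<theta> k x = potential \<theta> k x / growth \<theta> (card x)"

text \<open>The factor n + 1 + \<theta> of \<open>sum_potential\<close> is (n + 1) times the last
  factor of \<open>growth \<theta> (Suc n)\<close>; what remains is n + 1, the number of equally
  likely external nodes.\<close>

lemma norm_potential_step:
  assumes "\<theta> \<ge> 0" "x \<in> trees_of_card n" "n \<ge> 1"
  shows "(\<integral>\<^sup>+y. ennreal (norm_potential \<theta> k y) \<partial>bst_step x) = ennreal (norm_potential \<theta> k x)"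
proof -
  note x = trees_of_cardD[OF assms(2,3)]
  have g: "growth \<theta> m > 0" for m using growth_pos[OF assms(1)] .
  have c: "card (insert u x) = Suc n" if "u \<in> external x" for u
    using that x by (auto simp: external_def)
  have nn: "norm_potential \<theta> k y \<ge> 0" for y
    using g potential_nonneg[OF assms(1)] by (simp add: norm_potential_def less_imp_le)
  have "(\<Sum>u\<in>external x. norm_potential \<theta> k (insert u x)) =
      (\<Sum>u\<in>external x. potential \<theta> k (insert u x)) / growth \<theta> (Suc n)"
    unfolding sum_divide_distrib by (intro sum.cong) (auto simp: norm_potential_def c)
  also have "\<dots> = (real n + 1 + \<theta>) * potential \<theta> k x / growth \<theta> (Suc n)"
    using sum_potential[OF assms(1) x(1,2), of k] by (simp add: frontier_nodes_eq_external[OF x(4)] x(3))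
  also have "\<dots> = real (Suc n) * norm_potential \<theta> k x"
  proof -
    have "real n + 1 + \<theta> = real (Suc n) * (1 + \<theta> / real (Suc n))" by (simp add: field_simps)
    moreover have "1 + \<theta> / real (Suc n) > 0" using assms(1) by (intro add_pos_nonneg) auto
    ultimately show ?thesis by (simp add: norm_potential_def growth_Suc x(3) del: of_nat_Suc)
  qed
  finally have s: "(\<Sum>u\<in>external x. norm_potential \<theta> k (insert u x)) = real (Suc n) * norm_potential \<theta> k x" .
  have "(\<integral>\<^sup>+y. ennreal (norm_potential \<theta> k y) \<partial>bst_step x) =
      ennreal (real (Suc n) * norm_potential \<theta> k x) / ennreal (real (Suc n))"
    unfolding nn_integral_bst_step[OF assms(2,3)] by (simp add: sum_ennreal nn s ennreal_of_nat_eq_real_of_nat del: of_nat_Suc)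
  also have "\<dots> = ennreal (norm_potential \<theta> k x)"
    by (subst divide_ennreal) (auto simp: nn simp del: of_nat_Suc)
  finally show ?thesis .
qed

lemma norm_potential_root: "\<theta> \<ge> 0 \<Longrightarrow> norm_potential \<theta> k {[]} = (2 / (1 + \<theta>)) ^ k"
proof (cases k)
  case (Suc j)
  assume "\<theta> \<ge> 0"
  moreover have "branch b {[]} = {}" for b by (simp add: branch_def)
  ultimately show ?thesis using Suc by (simp add: norm_potential_def potential_empty growth_def)
qed (simp add: norm_potential_def growth_def)

text \<open>Tonelli against counting measure, since exactly one of the indicators is 1 at each
  point. It reduces integrals to the atoms on which the chain's transition law is given.\<close>

lemma nn_integral_countable_cases:
  assumes "countable I" "Y \<in> measurable M (count_space I)" "g \<in> borel_measurable M"
  shows "(\<integral>\<^sup>+\<omega>. g \<omega> \<partial>M) = (\<integral>\<^sup>+i. (\<integral>\<^sup>+\<omega>. g \<omega> * indicator {\<omega> \<in> space M. Y \<omega> = i} \<omega> \<partial>M) \<partial>count_space I)"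
proof -
  have sets: "{\<omega> \<in> space M. Y \<omega> = i} \<in> sets M" if "i \<in> I" for i
    using measurable_sets[OF assms(2), of "{i}"] that by (simp add: vimage_def Int_def conj_commute)
  have "(\<integral>\<^sup>+\<omega>. g \<omega> \<partial>M) = (\<integral>\<^sup>+\<omega>. (\<integral>\<^sup>+i. g \<omega> * indicator {\<omega> \<in> space M. Y \<omega> = i} \<omega> \<partial>count_space I) \<partial>M)"
  proof (rule nn_integral_cong)
    fix \<omega> assume \<omega>: "\<omega> \<in> space M"
    have Y: "Y \<omega> \<in> I" using measurable_space[OF assms(2) \<omega>] by simp
    have "(\<integral>\<^sup>+i. g \<omega> * indicator {\<omega> \<in> space M. Y \<omega> = i} \<omega> \<partial>count_space I) =
        (\<integral>\<^sup>+i. g \<omega> * indicator {Y \<omega>} i \<partial>count_space I)"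
      by (intro nn_integral_cong) (auto simp: indicator_def \<omega>)
    also have "\<dots> = g \<omega>" using Y by (simp add: nn_integral_cmult_indicator)
    finally show "g \<omega> = (\<integral>\<^sup>+i. g \<omega> * indicator {\<omega> \<in> space M. Y \<omega> = i} \<omega> \<partial>count_space I)" ..
  qed
  also have "\<dots> = (\<integral>\<^sup>+i. (\<integral>\<^sup>+\<omega>. g \<omega> * indicator {\<omega> \<in> space M. Y \<omega> = i} \<omega> \<partial>M) \<partial>count_space I)"
    by (rule nn_integral_count_space_nn_integral)
       (use assms sets in \<open>auto intro!: borel_measurable_times_ennreal borel_measurable_indicator\<close>)
  finally show ?thesis .
qed

text \<open>The exponent \<open>\<theta> > 0\<close> minimising \<open>(2 / (1 + \<theta>)) powr (1 / \<theta>)\<close>; the minimum is \<open>1 / rho0\<close>.\<close>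

definition theta0 :: real where
  "theta0 = 1 / ln rho0 - 1"

lemma ln_rho0: "0 < ln rho0" "ln rho0 < 1"
proof -
  show "0 < ln rho0" using rho0_bounds by simp
  have "rho0 < exp 1" using rho0_bounds exp_1_bounds by simp
  then have "ln rho0 < ln (exp 1)" using rho0_bounds by (subst ln_less_cancel_iff) auto
  then show "ln rho0 < 1" by simp
qed

lemma theta0_pos: "theta0 > 0"
  using ln_rho0 by (simp add: theta0_def)

text \<open>Since \<theta> ln rho0 = 1 - ln rho0 at \<open>theta0\<close>, the right side is rho0/e.
  The root equation turns this into 2 ln rho0, which is the left side.\<close>

lemma theta0_eq: "2 / (1 + theta0) = rho0 powr (- theta0)"
proof -
  have "rho0 > 0" using rho0_bounds by simp
  then have "rho0 powr (- theta0) = exp (ln rho0 - 1)"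
    using ln_rho0 by (simp add: powr_def theta0_def algebra_simps)
  also have "\<dots> = rho0 / exp 1" using \<open>rho0 > 0\<close> by (simp add: exp_diff)
  also have "\<dots> = 2 * ln rho0" using rho0_root by (simp add: divide_eq_eq mult_ac)
  finally show ?thesis using ln_rho0 by (simp add: theta0_def)
qed

section \<open>The Markov property along finite histories\<close>

locale bst_process = prob_space M for M :: "'w measure" +
  fixes X :: "nat \<Rightarrow> 'w \<Rightarrow> node set"
  assumes chain: "bst_chain M X"
begin

lemma measurable_X: "n \<ge> 1 \<Longrightarrow> X n \<in> measurable M (count_space trees)"
  using chain by (simp add: bst_chain_def)

lemma X_in_trees: "n \<ge> 1 \<Longrightarrow> \<omega> \<in> space M \<Longrightarrow> X n \<omega> \<in> trees"
  using measurable_space[OF measurable_X] by auto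

lemma measurable_fun_X:
  assumes "n \<ge> 1" "\<And>x. f x \<in> space N"
  shows "(\<lambda>\<omega>. f (X n \<omega>)) \<in> measurable M N"
  using measurable_compose[OF measurable_X[OF assms(1)], of f N] assms(2) by simp

lemma sets_X_eq: "n \<ge> 1 \<Longrightarrow> {\<omega> \<in> space M. P (X n \<omega>)} \<in> sets M"
  using measurable_fun_X[of n P "count_space UNIV"] by (simp add: pred_def)

text \<open>Restriction makes a history an extensional function, so that there are countably many of
  them and each one names a conditioning event of \<open>bst_chain\<close>.\<close>

definition history :: "nat \<Rightarrow> 'w \<Rightarrow> nat \<Rightarrow> node set" where
  "history n \<omega> = restrict (\<lambda>i. X i \<omega>) {1..n}"

lemma history_eq_iff: "h \<in> extensional {1..n} \<Longrightarrow> history n \<omega> = h \<longleftrightarrow> (\<forall>i\<in>{1..n}. X i \<omega> = h i)"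
  by (auto simp: history_def fun_eq_iff restrict_def extensional_def)

lemma countable_histories: "countable (PiE {1..n::nat} (\<lambda>_. trees))"
  by (intro countable_PiE) (auto simp: countable_trees)

lemma history_in: "\<omega> \<in> space M \<Longrightarrow> history n \<omega> \<in> PiE {1..n} (\<lambda>_. trees)"
  using X_in_trees by (fastforce simp: history_def PiE_iff)

lemma sets_history: "h \<in> PiE {1..n} (\<lambda>_. trees) \<Longrightarrow> {\<omega> \<in> space M. history n \<omega> = h} \<in> sets M"
proof -
  assume "h \<in> PiE {1..n} (\<lambda>_. trees)"
  then have "{\<omega> \<in> space M. history n \<omega> = h} = {\<omega> \<in> space M. \<forall>i\<in>{1..n}. X i \<omega> = h i}"
    by (auto simp: history_eq_iff PiE_iff)
  also have "\<dots> \<in> sets M"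
    by (rule sets.sets_Collect_finite_All) (use sets_X_eq in auto)
  finally show ?thesis .
qed

lemma measurable_history: "history n \<in> measurable M (count_space (PiE {1..n} (\<lambda>_. trees)))"
proof (subst measurable_count_space_eq_countable[OF countable_histories], intro conjI ballI)
  show "history n \<in> space M \<rightarrow> PiE {1..n} (\<lambda>_. trees)" using history_in by blast
  fix h assume "h \<in> PiE {1..n} (\<lambda>_. trees)"
  from sets_history[OF this] show "history n -` {h} \<inter> space M \<in> sets M"
    by (simp add: vimage_def Int_def conj_commute)
qed

text \<open>The product form includes histories of probability zero, about which
  \<open>bst_chain\<close> says nothing; both sides vanish there.\<close>

lemma emeasure_history_step:
  assumes "n \<ge> 1" "h \<in> PiE {1..n} (\<lambda>_. trees)"
  shows "emeasure M {\<omega> \<in> space M. history n \<omega> = h \<and> X (Suc n) \<omega> = y} =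
    ennreal (pmf (bst_step (h n)) y) * emeasure M {\<omega> \<in> space M. history n \<omega> = h}"
proof -
  let ?A = "{\<omega> \<in> space M. history n \<omega> = h}"
  let ?B = "{\<omega> \<in> space M. history n \<omega> = h \<and> X (Suc n) \<omega> = y}"
  have A: "?A = {\<omega> \<in> space M. \<forall>i\<in>{1..n}. X i \<omega> = h i}"
    using assms(2) by (auto simp: history_eq_iff PiE_iff)
  have B: "?B = {\<omega> \<in> space M. X (Suc n) \<omega> = y \<and> (\<forall>i\<in>{1..n}. X i \<omega> = h i)}"
    using assms(2) by (auto simp: history_eq_iff PiE_iff)
  have "prob ?B = pmf (bst_step (h n)) y * prob ?A"
  proof (cases "prob ?A > 0")
    case True
    then have "cond_prob M (\<lambda>\<omega>. X (Suc n) \<omega> = y) (\<lambda>\<omega>. \<forall>i\<in>{1..n}. X i \<omega> = h i) = pmf (bst_step (h n)) y"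
      using chain assms(1) unfolding bst_chain_def A by blast
    then have "prob ?B / prob ?A = pmf (bst_step (h n)) y"
      unfolding cond_prob_def A B .
    then show ?thesis using True by (simp add: field_simps)
  next
    case False
    then have "prob ?A = 0" using measure_nonneg[of M ?A] by linarith
    moreover have "prob ?B \<le> prob ?A"
      by (rule finite_measure_mono) (use sets_history[OF assms(2)] in auto)
    ultimately show ?thesis using measure_nonneg[of M ?B] by simp
  qed
  then show ?thesis by (simp add: emeasure_eq_measure ennreal_mult)
qed

text \<open>The tower property, obtained by summing over all histories and all next trees. The
  inequality sign comes from summing the transition probabilities over \<open>trees\<close> only,
  and it suffices for a supermartingale argument. Countability makes every \<open>f\<close> and
  \<open>H\<close> admissible.\<close>

lemma nn_integral_step_le:
  assumes n: "n \<ge> 1"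
  shows "(\<integral>\<^sup>+\<omega>. f (X (Suc n) \<omega>) * indicator {\<omega>. H (history n \<omega>)} \<omega> \<partial>M) \<le>
    (\<integral>\<^sup>+\<omega>. (\<integral>\<^sup>+y. f y \<partial>bst_step (X n \<omega>)) * indicator {\<omega>. H (history n \<omega>)} \<omega> \<partial>M)"
proof -
  let ?E = "PiE {1..n} (\<lambda>_. trees)"
  let ?I = "\<lambda>\<omega>. indicator {\<omega>. H (history n \<omega>)} \<omega> :: ennreal"
  have [measurable]: "(\<lambda>\<omega>. ?I \<omega>) \<in> borel_measurable M"
  proof -
    have "(\<lambda>\<omega>. indicator (Collect H) (history n \<omega>) :: ennreal) \<in> borel_measurable M"
      by (rule measurable_compose[OF measurable_history]) simp
    then show ?thesis by (simp add: indicator_def)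
  qed
  have [measurable]: "(\<lambda>\<omega>. f (X (Suc n) \<omega>)) \<in> borel_measurable M"
    "(\<lambda>\<omega>. \<integral>\<^sup>+y. f y \<partial>bst_step (X n \<omega>)) \<in> borel_measurable M"
    using measurable_fun_X[of "Suc n" _ borel] measurable_fun_X[of n _ borel] n by simp_all
  have inner: "(\<integral>\<^sup>+\<omega>. f (X (Suc n) \<omega>) * ?I \<omega> * indicator {\<omega> \<in> space M. history n \<omega> = h} \<omega> \<partial>M) \<le>
     (\<integral>\<^sup>+\<omega>. (\<integral>\<^sup>+y. f y \<partial>bst_step (X n \<omega>)) * ?I \<omega> * indicator {\<omega> \<in> space M. history n \<omega> = h} \<omega> \<partial>M)"
    if h: "h \<in> ?E" for h
  proof -
    let ?A = "{\<omega> \<in> space M. history n \<omega> = h}"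
    have hX: "X n \<omega> = h n" if "history n \<omega> = h" for \<omega>
      using that n by (auto simp: history_def)
    have setA [measurable]: "?A \<in> sets M" using sets_history[OF h] .
    have setB: "{\<omega> \<in> space M. history n \<omega> = h \<and> X (Suc n) \<omega> = y} \<in> sets M" for y
      using sets.Int[OF setA sets_X_eq[of "Suc n" "\<lambda>x. x = y"]] by (simp add: Int_def conj_ac)
    have "(\<integral>\<^sup>+\<omega>. f (X (Suc n) \<omega>) * ?I \<omega> * indicator ?A \<omega> \<partial>M) =
      (\<integral>\<^sup>+y. (\<integral>\<^sup>+\<omega>. f (X (Suc n) \<omega>) * ?I \<omega> * indicator ?A \<omega> * indicator {\<omega> \<in> space M. X (Suc n) \<omega> = y} \<omega> \<partial>M) \<partial>count_space trees)"
      by (rule nn_integral_countable_cases[OF countable_trees measurable_X]) auto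
    also have "\<dots> = (\<integral>\<^sup>+y. (\<integral>\<^sup>+\<omega>. (f y * indicator (Collect H) h) *
        indicator {\<omega> \<in> space M. history n \<omega> = h \<and> X (Suc n) \<omega> = y} \<omega> \<partial>M) \<partial>count_space trees)"
      by (intro nn_integral_cong) (auto simp: indicator_def)
    also have "\<dots> = (\<integral>\<^sup>+y. (f y * indicator (Collect H) h) *
        (ennreal (pmf (bst_step (h n)) y) * emeasure M ?A) \<partial>count_space trees)"
      by (intro nn_integral_cong, subst nn_integral_cmult_indicator)
         (auto simp: setB emeasure_history_step[OF n h])
    also have "\<dots> = (\<integral>\<^sup>+y. ennreal (pmf (bst_step (h n)) y) * f y * (indicator (Collect H) h * emeasure M ?A) \<partial>count_space trees)"
      by (intro nn_integral_cong) (simp add: mult_ac)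
    also have "\<dots> = (\<integral>\<^sup>+y. ennreal (pmf (bst_step (h n)) y) * f y \<partial>count_space trees) * (indicator (Collect H) h * emeasure M ?A)"
      by (rule nn_integral_multc) simp
    also have "\<dots> \<le> (\<integral>\<^sup>+y. ennreal (pmf (bst_step (h n)) y) * f y \<partial>count_space UNIV) * (indicator (Collect H) h * emeasure M ?A)"
      by (intro mult_right_mono) (auto simp: nn_integral_count_space_indicator indicator_def intro!: nn_integral_mono)
    also have "\<dots> = (\<integral>\<^sup>+y. f y \<partial>bst_step (h n)) * (indicator (Collect H) h * emeasure M ?A)"
      by (simp add: nn_integral_measure_pmf)
    also have "\<dots> = (\<integral>\<^sup>+\<omega>. ((\<integral>\<^sup>+y. f y \<partial>bst_step (h n)) * indicator (Collect H) h) * indicator ?A \<omega> \<partial>M)"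
      by (subst nn_integral_cmult_indicator) (auto simp: setA mult_ac)
    also have "\<dots> = (\<integral>\<^sup>+\<omega>. (\<integral>\<^sup>+y. f y \<partial>bst_step (X n \<omega>)) * ?I \<omega> * indicator ?A \<omega> \<partial>M)"
      by (intro nn_integral_cong) (auto simp: indicator_def hX)
    finally show ?thesis .
  qed
  note cases = nn_integral_countable_cases[OF countable_histories[of n] measurable_history[of n]]
  have m: "(\<lambda>\<omega>. f (X (Suc n) \<omega>) * ?I \<omega>) \<in> borel_measurable M"
    "(\<lambda>\<omega>. (\<integral>\<^sup>+y. f y \<partial>bst_step (X n \<omega>)) * ?I \<omega>) \<in> borel_measurable M"
    by measurable
  show ?thesis
    unfolding cases[OF m(1)] cases[OF m(2)] by (rule nn_integral_mono, rule inner) simp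
qed

text \<open>The step inequality is applied to the indicator of the bad trees, whose mean after one
  step from a good tree is zero.\<close>

lemma AE_trees_of_card: "n \<ge> 1 \<Longrightarrow> AE \<omega> in M. X n \<omega> \<in> trees_of_card n"
proof (induction n rule: nat_induct_at_least)
  case base
  have "AE \<omega> in M. X 1 \<omega> = {[]}" using chain by (simp add: bst_chain_def)
  then show ?case by eventually_elim (auto simp: trees_of_card_def binary_tree_def)
next
  case (Suc n)
  let ?f = "indicator (- trees_of_card (Suc n)) :: node set \<Rightarrow> ennreal"
  have "(\<integral>\<^sup>+\<omega>. ?f (X (Suc n) \<omega>) \<partial>M) \<le> (\<integral>\<^sup>+\<omega>. (\<integral>\<^sup>+y. ?f y \<partial>bst_step (X n \<omega>)) \<partial>M)"
    using nn_integral_step_le[OF Suc.hyps, of ?f "\<lambda>_. True"] by simp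
  also have "\<dots> = (\<integral>\<^sup>+\<omega>. 0 \<partial>M)"
  proof (rule nn_integral_cong_AE)
    show "AE \<omega> in M. (\<integral>\<^sup>+y. ?f y \<partial>bst_step (X n \<omega>)) = 0"
      using Suc.IH
    proof eventually_elim
      case (elim \<omega>)
      then have "AE y in bst_step (X n \<omega>). ?f y = 0"
        using set_bst_step[OF elim Suc.hyps] by (auto simp: AE_measure_pmf_iff indicator_def)
      then show ?case by (subst nn_integral_0_iff_AE) auto
    qed
  qed
  finally have "(\<integral>\<^sup>+\<omega>. ?f (X (Suc n) \<omega>) \<partial>M) = 0" by simp
  moreover have "(\<lambda>\<omega>. ?f (X (Suc n) \<omega>)) \<in> borel_measurable M"
    by (rule measurable_fun_X) auto
  ultimately have "AE \<omega> in M. ?f (X (Suc n) \<omega>) = 0"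
    by (simp add: nn_integral_0_iff_AE)
  then show ?case by eventually_elim (auto simp: indicator_def split: if_splits)
qed

lemma AE_all_trees_of_card: "AE \<omega> in M. \<forall>n\<ge>1. X n \<omega> \<in> trees_of_card n"
  using AE_trees_of_card by (simp add: AE_all_countable)

text \<open>Ville's inequality: the expectation of the process stopped on reaching \<open>a\<close> does not increase.\<close>

lemma emeasure_norm_potential_ge:
  assumes "\<theta> \<ge> 0" "a > 0"
  shows "emeasure M {\<omega> \<in> space M. \<exists>n\<ge>1. a \<le> norm_potential \<theta> k (X n \<omega>)} \<le> ennreal ((2 / (1 + \<theta>)) ^ k / a)"
proof -
  let ?c = "(2 / (1 + \<theta>)) ^ k"
  define \<Phi> where "\<Phi> x = norm_potential \<theta> k x" for x
  define A where "A n = {\<omega>. \<forall>i\<in>{1..n}. \<Phi> (X i \<omega>) < a}" for n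
  define B where "B n = {\<omega> \<in> space M. \<exists>i\<in>{1..n}. a \<le> \<Phi> (X i \<omega>)}" for n
  \<comment> \<open>\<open>V n\<close> is the mean of the process stopped on reaching
    \<open>a\<close>, with the overshoot cut off to exactly \<open>a\<close>.\<close>
  define V where "V n = (\<integral>\<^sup>+\<omega>. ennreal (\<Phi> (X n \<omega>)) * indicator (A n) \<omega> + ennreal a * indicator (B n) \<omega> \<partial>M)" for n
  have c0: "?c \<ge> 0" using assms(1) by simp
  have mX [measurable]: "(\<lambda>\<omega>. ennreal (\<Phi> (X n \<omega>))) \<in> borel_measurable M" if "n \<ge> 1" for n
    using measurable_fun_X[OF that, of "\<lambda>x. ennreal (\<Phi> x)" borel] by simp
  have B_sets [measurable]: "B n \<in> sets M" for n
    unfolding B_def using sets_X_eq by (intro sets.sets_Collect_finite_Ex) auto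
  have A_sets: "A n \<inter> space M \<in> sets M" for n
  proof -
    have "A n \<inter> space M = space M - B n" by (force simp: A_def B_def not_less)
    then show ?thesis by simp
  qed
  have A_meas [measurable]: "(indicator (A n) :: _ \<Rightarrow> ennreal) \<in> borel_measurable M" for n
    using A_sets by (simp add: borel_measurable_indicator_iff)
  have V_Suc: "V (Suc n) \<le> V n" if n: "n \<ge> 1" for n
  proof -
    have H: "A n = {\<omega>. \<forall>i\<in>{1..n}. \<Phi> (history n \<omega> i) < a}"
      by (auto simp: A_def history_def)
    \<comment> \<open>Where \<open>a\<close> is first reached at time n + 1, the process is at least
      \<open>a\<close>, so the stopped value \<open>a\<close> is no larger.\<close>
    have "V (Suc n) \<le> (\<integral>\<^sup>+\<omega>. ennreal (\<Phi> (X (Suc n) \<omega>)) * indicator (A n) \<omega> + ennreal a * indicator (B n) \<omega> \<partial>M)"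
      unfolding V_def
    proof (rule nn_integral_mono)
      fix \<omega> assume \<omega>: "\<omega> \<in> space M"
      have s: "{1..Suc n} = insert (Suc n) {1..n}" by auto
      show "ennreal (\<Phi> (X (Suc n) \<omega>)) * indicator (A (Suc n)) \<omega> + ennreal a * indicator (B (Suc n)) \<omega>
        \<le> ennreal (\<Phi> (X (Suc n) \<omega>)) * indicator (A n) \<omega> + ennreal a * indicator (B n) \<omega>"
        unfolding A_def B_def s using \<omega> by (auto simp: indicator_def not_le not_less intro!: ennreal_leI)
    qed
    also have "\<dots> = (\<integral>\<^sup>+\<omega>. ennreal (\<Phi> (X (Suc n) \<omega>)) * indicator (A n) \<omega> \<partial>M) + (\<integral>\<^sup>+\<omega>. ennreal a * indicator (B n) \<omega> \<partial>M)"
      using mX[of "Suc n"] by (intro nn_integral_add) auto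
    also have "(\<integral>\<^sup>+\<omega>. ennreal (\<Phi> (X (Suc n) \<omega>)) * indicator (A n) \<omega> \<partial>M) \<le>
       (\<integral>\<^sup>+\<omega>. (\<integral>\<^sup>+y. ennreal (\<Phi> y) \<partial>bst_step (X n \<omega>)) * indicator (A n) \<omega> \<partial>M)"
      unfolding H by (rule nn_integral_step_le[OF n])
    also have "\<dots> = (\<integral>\<^sup>+\<omega>. ennreal (\<Phi> (X n \<omega>)) * indicator (A n) \<omega> \<partial>M)"
      by (rule nn_integral_cong_AE, use AE_trees_of_card[OF n] in eventually_elim)
         (simp add: \<Phi>_def norm_potential_step[OF assms(1) _ n])
    also have "\<dots> + (\<integral>\<^sup>+\<omega>. ennreal a * indicator (B n) \<omega> \<partial>M) = V n"
      unfolding V_def using mX[OF n] by (intro nn_integral_add[symmetric]) auto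
    finally show ?thesis by (simp add: add_right_mono)
  qed
  have V1: "V 1 \<le> ennreal ?c"
  proof -
    have "AE \<omega> in M. X 1 \<omega> = {[]}" using chain by (simp add: bst_chain_def)
    then have "AE \<omega> in M. ennreal (\<Phi> (X 1 \<omega>)) * indicator (A 1) \<omega> + ennreal a * indicator (B 1) \<omega> \<le> ennreal ?c"
    proof eventually_elim
      case (elim \<omega>)
      have "\<Phi> (X 1 \<omega>) = ?c" using norm_potential_root[OF assms(1)] elim by (simp add: \<Phi>_def)
      then show ?case
        by (cases "?c < a") (auto simp: A_def B_def not_less ennreal_leI split: split_indicator)
    qed
    then have "V 1 \<le> (\<integral>\<^sup>+\<omega>. ennreal ?c \<partial>M)" unfolding V_def by (rule nn_integral_mono_AE)
    then show ?thesis by (simp add: emeasure_space_1)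
  qed
  have V: "V n \<le> ennreal ?c" if "n \<ge> 1" for n
    using that
  proof (induction n rule: nat_induct_at_least)
    case (Suc n)
    then show ?case using V_Suc[of n] by (meson order_trans)
  qed (rule V1)
  have B: "emeasure M (B n) \<le> ennreal (?c / a)" if n: "n \<ge> 1" for n
  proof -
    have "ennreal (a * prob (B n)) = (\<integral>\<^sup>+\<omega>. ennreal a * indicator (B n) \<omega> \<partial>M)"
      using assms(2) by (simp add: nn_integral_cmult_indicator emeasure_eq_measure ennreal_mult)
    also have "\<dots> \<le> V n" unfolding V_def by (intro nn_integral_mono) simp
    also have "\<dots> \<le> ennreal ?c" by (rule V[OF n])
    finally have "a * prob (B n) \<le> ?c" using c0 by (simp add: ennreal_le_iff)
    then have "prob (B n) \<le> ?c / a" using assms(2) by (simp only: pos_le_divide_eq mult.commute)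
    then show ?thesis unfolding emeasure_eq_measure by (rule ennreal_leI)
  qed
  have inc: "incseq B" by (rule monoI) (force simp: B_def)
  have "{\<omega> \<in> space M. \<exists>n\<ge>1. a \<le> norm_potential \<theta> k (X n \<omega>)} = (\<Union>n. B n)"
    by (force simp: B_def \<Phi>_def)
  also have "emeasure M (\<Union>n. B n) = (SUP n. emeasure M (B n))"
    using inc by (intro SUP_emeasure_incseq[symmetric]) auto
  also have "\<dots> \<le> ennreal (?c / a)"
  proof (rule SUP_least)
    fix n
    \<comment> \<open>The bound is known for n \<ge> 1; moving on to \<open>Suc n\<close> covers n =
      0 as well.\<close>
    have "emeasure M (B n) \<le> emeasure M (B (Suc n))"
      using inc by (intro emeasure_mono) (auto simp: incseq_Suc_iff)
    also have "\<dots> \<le> ennreal (?c / a)" by (rule B) simp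
    finally show "emeasure M (B n) \<le> ennreal (?c / a)" .
  qed
  finally show ?thesis .
qed

section \<open>Suprema of the subtree ratios over a level and over all times\<close>

definition level_sup :: "nat \<Rightarrow> 'w \<Rightarrow> ennreal" where
  "level_sup k \<omega> = (SUP n\<in>{1..}. SUP u\<in>{u. length u = k}. ennreal (real (subtree_size (X n \<omega>) u) / real n))"

lemma measurable_level_sup [measurable]: "level_sup k \<in> borel_measurable M"
  unfolding level_sup_def
  by (intro borel_measurable_SUP measurable_fun_X[where N=borel]) auto

lemma ratio_le_level_sup: "n \<ge> 1 \<Longrightarrow> ennreal (real (subtree_size (X n \<omega>) u) / real n) \<le> level_sup (length u) \<omega>"
  unfolding level_sup_def by (rule SUP_upper2[of n], simp, rule SUP_upper2[of u]) auto

lemma level_sup_le_1: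
  assumes "\<forall>n\<ge>1. X n \<omega> \<in> trees_of_card n"
  shows "level_sup k \<omega> \<le> 1"
  unfolding level_sup_def
proof (intro SUP_least)
  fix n u assume "n \<in> {1::nat..}"
  then have n: "n \<ge> 1" by simp
  then have "real (subtree_size (X n \<omega>) u) \<le> real n"
    using subtree_size_le_card[of "X n \<omega>" u] assms by (auto simp: trees_of_card_def)
  then show "ennreal (real (subtree_size (X n \<omega>) u) / real n) \<le> 1"
    using n by (simp add: ennreal_le_1)
qed

text \<open>A single node with ratio above t already lifts the potential of its whole level to
  t^\<theta>, so no union bound over nodes or times is paid.\<close>

lemma emeasure_level_sup_gt:
  assumes "\<theta> \<ge> 0" "t > 0"
  shows "emeasure M {\<omega> \<in> space M. ennreal t < level_sup k \<omega>} \<le> ennreal ((2 / (1 + \<theta>)) ^ k / t powr \<theta>)"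
proof -
  have "emeasure M {\<omega> \<in> space M. ennreal t < level_sup k \<omega>} \<le>
      emeasure M {\<omega> \<in> space M. \<exists>n\<ge>1. t powr \<theta> \<le> norm_potential \<theta> k (X n \<omega>)}"
  proof (rule emeasure_mono_AE)
    have "{\<omega> \<in> space M. 1 \<le> n \<and> t powr \<theta> \<le> norm_potential \<theta> k (X n \<omega>)} \<in> sets M" for n
    proof (cases "1 \<le> n")
      case True
      show ?thesis by (rule sets_X_eq[OF True])
    next
      case False
      then have "{\<omega> \<in> space M. 1 \<le> n \<and> t powr \<theta> \<le> norm_potential \<theta> k (X n \<omega>)} = {}" by blast
      then show ?thesis by (simp only: sets.empty_sets)
    qed
    then show "{\<omega> \<in> space M. \<exists>n\<ge>1. t powr \<theta> \<le> norm_potential \<theta> k (X n \<omega>)} \<in> sets M"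
      by (rule sets.sets_Collect_countable_Ex)
    show "AE \<omega> in M. \<omega> \<in> {\<omega> \<in> space M. ennreal t < level_sup k \<omega>} \<longrightarrow>
        \<omega> \<in> {\<omega> \<in> space M. \<exists>n\<ge>1. t powr \<theta> \<le> norm_potential \<theta> k (X n \<omega>)}"
      using AE_all_trees_of_card
    proof eventually_elim
      case (elim \<omega>)
      have "\<exists>n\<ge>1. t powr \<theta> \<le> norm_potential \<theta> k (X n \<omega>)" if "ennreal t < level_sup k \<omega>"
      proof -
        from that obtain n u where n: "n \<ge> 1" "length u = k"
          and "ennreal t < ennreal (real (subtree_size (X n \<omega>) u) / real n)"
          by (auto simp: level_sup_def less_SUP_iff)
        then have t: "t < real (subtree_size (X n \<omega>) u) / real n"
          using assms(2) by (simp add: ennreal_less_iff)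
        have x: "finite (X n \<omega>)" "binary_tree (X n \<omega>)" "card (X n \<omega>) = n"
          using elim n by (auto simp: trees_of_card_def)
        have "t powr \<theta> \<le> (real (subtree_size (X n \<omega>) u) / real n) powr \<theta>"
          using t assms by (intro powr_mono2) auto
        also have "\<dots> \<le> norm_potential \<theta> k (X n \<omega>)"
          using subtree_ratio_le_potential[OF assms(1) x(1,2), of u] n x(3) by (simp add: norm_potential_def)
        finally show ?thesis using n by blast
      qed
      then show ?case by simp
    qed
  qed
  also have "\<dots> \<le> ennreal ((2 / (1 + \<theta>)) ^ k / t powr \<theta>)"
    using assms by (intro emeasure_norm_potential_ge) auto
  finally show ?thesis .
qed

text \<open>At \<theta> = \<open>theta0\<close> and t = c^(-k) the tail bound is geometric in k, and
  its ratio is below 1 when c < \<open>rho0\<close>.\<close>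

lemma emeasure_level_sup_gt_power:
  assumes "c > 0"
  shows "emeasure M {\<omega> \<in> space M. ennreal ((1 / c) ^ k) < level_sup k \<omega>} \<le> ennreal (((c / rho0) powr theta0) ^ k)"
proof -
  have r: "rho0 > 0" using rho0_bounds by simp
  have eq: "(2 / (1 + theta0)) ^ k / ((1 / c) ^ k) powr theta0 = ((c / rho0) powr theta0) ^ k"
  proof -
    have "((1 / c) ^ k) powr theta0 = ((1 / c) powr theta0) ^ k"
      using assms by (simp add: powr_realpow[symmetric] powr_powr mult.commute)
    moreover have "rho0 powr (- theta0) / (1 / c) powr theta0 = (c / rho0) powr theta0"
      using assms r by (simp add: powr_divide powr_minus field_simps)
    ultimately show ?thesis unfolding theta0_eq by (metis power_divide)
  qed
  have "(1 / c) ^ k > 0" using assms by simp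
  from emeasure_level_sup_gt[OF less_imp_le[OF theta0_pos] this, of k] show ?thesis unfolding eq .
qed

lemma ratio_powr_less_1: "0 < c \<Longrightarrow> c < rho0 \<Longrightarrow> (c / rho0) powr theta0 < 1"
  using powr_less_mono2[of theta0 "c / rho0" 1] theta0_pos by simp

text \<open>Split at the threshold c^(-k); above it the supremum is still at most 1 almost
  surely.\<close>

lemma nn_integral_level_sup_le:
  assumes "c > 0"
  shows "(\<integral>\<^sup>+\<omega>. level_sup k \<omega> \<partial>M) \<le> ennreal ((1 / c) ^ k + ((c / rho0) powr theta0) ^ k)"
proof -
  let ?t = "ennreal ((1 / c) ^ k)" and ?A = "{\<omega> \<in> space M. ennreal ((1 / c) ^ k) < level_sup k \<omega>}"
  have [measurable]: "?A \<in> sets M" by measurable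
  have "(\<integral>\<^sup>+\<omega>. level_sup k \<omega> \<partial>M) \<le> (\<integral>\<^sup>+\<omega>. ?t + indicator ?A \<omega> \<partial>M)"
  proof (rule nn_integral_mono_AE, use AE_all_trees_of_card AE_space in eventually_elim)
    case (elim \<omega>)
    have "level_sup k \<omega> \<le> ?t + 1"
      using level_sup_le_1[OF elim(1), of k] by (rule add_increasing[OF zero_le])
    then show ?case using elim(2) by (auto simp: indicator_def not_less)
  qed
  also have "\<dots> = ?t + emeasure M ?A"
    by (subst nn_integral_add) (auto simp: emeasure_space_1)
  also have "\<dots> \<le> ?t + ennreal (((c / rho0) powr theta0) ^ k)"
    by (intro add_left_mono emeasure_level_sup_gt_power assms)
  also have "\<dots> = ennreal ((1 / c) ^ k + ((c / rho0) powr theta0) ^ k)"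
    using assms by (subst ennreal_plus) auto
  finally show ?thesis .
qed

lemma nn_integral_suminf_level_sup: "(\<integral>\<^sup>+\<omega>. (\<Sum>k. level_sup (Suc k) \<omega>) \<partial>M) < \<infinity>"
proof -
  \<comment> \<open>Any c strictly between 1 and \<open>rho0\<close> makes both geometric series
    converge; here c = 11/10.\<close>
  define r where "r = (11 / 10 / rho0) powr theta0"
  have r: "0 \<le> r" "r < 1" using ratio_powr_less_1[of "11/10"] rho0_bounds by (auto simp: r_def)
  have sm: "summable (\<lambda>k. (10 / 11 :: real) ^ Suc k + r ^ Suc k)"
    using r by (intro summable_add summable_geometric summable_Suc_iff[THEN iffD2]) auto
  have "(\<integral>\<^sup>+\<omega>. (\<Sum>k. level_sup (Suc k) \<omega>) \<partial>M) = (\<Sum>k. \<integral>\<^sup>+\<omega>. level_sup (Suc k) \<omega> \<partial>M)"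
    by (rule nn_integral_suminf) simp
  also have "\<dots> \<le> (\<Sum>k. ennreal ((10 / 11) ^ Suc k + r ^ Suc k))"
  proof (rule suminf_le)
    show "(\<integral>\<^sup>+\<omega>. level_sup (Suc k) \<omega> \<partial>M) \<le> ennreal ((10 / 11) ^ Suc k + r ^ Suc k)" for k
      using nn_integral_level_sup_le[of "11/10" "Suc k"] by (simp add: r_def del: power_Suc ennreal_plus)
  qed simp_all
  also have "\<dots> = ennreal (\<Sum>k. (10 / 11) ^ Suc k + r ^ Suc k)"
    using r sm by (intro suminf_ennreal2) auto
  also have "\<dots> < \<infinity>" by simp
  finally show ?thesis .
qed

text \<open>By Borel--Cantelli the bound c^(-k) fails for finitely many levels only. These are
  absorbed into the constant, since the suprema are at most 1.\<close>

lemma AE_level_sup_geometric: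
  assumes "0 < c" "c < rho0"
  shows "AE \<omega> in M. \<exists>C. \<forall>k. level_sup k \<omega> \<le> ennreal (C * (1 / c) ^ k)"
proof -
  define r where "r = (c / rho0) powr theta0"
  have r: "0 \<le> r" "r < 1" using ratio_powr_less_1[OF assms] by (auto simp: r_def)
  let ?A = "\<lambda>k. {\<omega> \<in> space M. ennreal ((1 / c) ^ k) < level_sup k \<omega>}"
  have "prob (?A k) \<le> r ^ k" for k
    using emeasure_level_sup_gt_power[OF assms(1), of k] r by (simp add: emeasure_eq_measure r_def)
  then have "summable (\<lambda>k. prob (?A k))"
    using r by (intro summable_comparison_test'[OF summable_geometric[of r]]) auto
  then have "AE \<omega> in M. eventually (\<lambda>k. \<omega> \<in> space M - ?A k) sequentially"
    by (intro borel_cantelli_AE1) (auto simp: less_top[symmetric])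
  then show ?thesis
    using AE_all_trees_of_card
  proof eventually_elim
    case (elim \<omega>)
    from elim(1) obtain K where K: "\<And>k. k \<ge> K \<Longrightarrow> level_sup k \<omega> \<le> ennreal ((1 / c) ^ k)"
      by (auto simp: eventually_sequentially not_less)
    \<comment> \<open>This choice gives C c^(-k) \<ge> 1 for all k < K, whether c is above or below
      1.\<close>
    define C where "C = max 1 (max 1 c ^ K)"
    have C: "C \<ge> 1" "max 1 c ^ K \<le> C" by (auto simp: C_def)
    have "level_sup k \<omega> \<le> ennreal (C * (1 / c) ^ k)" for k
    proof (cases "k \<ge> K")
      case True
      have "(1 / c) ^ k \<le> C * (1 / c) ^ k"
        using C(1) assms(1) mult_right_mono[of 1 C "(1 / c) ^ k"] by simp
      then show ?thesis using K[OF True] by (meson ennreal_leI order_trans)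
    next
      case False
      have "c ^ k \<le> max 1 c ^ k" using assms(1) by (intro power_mono) auto
      also have "\<dots> \<le> max 1 c ^ K" using False by (intro power_increasing) auto
      also have "\<dots> \<le> C" by (rule C)
      finally have "1 \<le> C * (1 / c) ^ k" using assms(1) by (simp add: field_simps)
      then have "1 \<le> ennreal (C * (1 / c) ^ k)" by (simp only: ennreal_ge_1)
      then show ?thesis by (rule order_trans[OF level_sup_le_1[OF elim(2)]])
    qed
    then show ?case by blast
  qed
qed

end

section \<open>Sums over cylinders\<close>

lemma cyl_sets [measurable]: "cyl (ray_prefix v k) \<in> sets borel"
  using open_cyl by (rule borel_open)

lemma node_eq_ray_prefix: "\<exists>v. u = ray_prefix v (length u)"
  by (intro exI[of _ "\<lambda>i. u ! i"]) (simp add: ray_prefix_def map_nth)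

lemma take_Suc_ray_prefix: "k < n \<Longrightarrow> take (Suc k) (ray_prefix v n) = ray_prefix v (Suc k)"
  by (simp add: take_ray_prefix min_absorb1)

lemma finite_level: "finite {u::node. length u = k}"
  using finite_lists_length_eq[of "UNIV :: bool set" k] by simp

lemma neg_log2_dist:
  "neg_log2 (dist (End u) (End v)) = (\<Sum>k. indicator (cyl (ray_prefix v (Suc k))) u)"
proof -
  let ?m = "meet_len (End u) (End v)"
  have d: "dist (End u) (End v) = half_pow ?m" by (rule dist_End)
  have ind: "u \<in> cyl (ray_prefix v (Suc k)) \<longleftrightarrow> half_pow ?m < (1 / 2) ^ k" for k
    using dist_End_less[of v u k] by (simp add: d dist_commute)
  show ?thesis
  proof (cases ?m)
    case (enat j)
    have "u \<in> cyl (ray_prefix v (Suc k)) \<longleftrightarrow> k < j" for k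
      unfolding ind enat by (simp add: power_strict_decreasing_iff)
    then have i: "indicator (cyl (ray_prefix v (Suc k))) u = (if k < j then 1 else 0 :: ennreal)" for k
      by (simp add: indicator_def)
    have "(\<Sum>k. indicator (cyl (ray_prefix v (Suc k))) u) = (\<Sum>k<j. 1 :: ennreal)"
      unfolding i by (subst suminf_finite[of "{..<j}"]) auto
    moreover have "- log 2 ((1 / 2) ^ j) = real j"
      by (simp add: power_one_over log_divide log_nat_power)
    ultimately show ?thesis
      by (simp add: d enat neg_log2_def ennreal_of_nat_eq_real_of_nat)
  next
    \<comment> \<open>For u = v all cylinders contain u, and the infinite count agrees with the
      convention for -log 0.\<close>
    case infinity
    have "(\<Sum>k. 1 :: ennreal) = \<infinity>"
      using nn_integral_count_space_nat[of "\<lambda>_. 1"] by simp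
    then show ?thesis using infinity ind by (simp add: d neg_log2_def indicator_def)
  qed
qed

definition cyl_sum :: "ray measure \<Rightarrow> ray \<Rightarrow> ennreal" where
  "cyl_sum \<mu> v = (\<Sum>k. emeasure \<mu> (cyl (ray_prefix v (Suc k))))"

lemma Sigma_inf_eq:
  assumes "sets \<mu> = sets borel"
  shows "Sigma_inf \<mu> v = enn2ereal (cyl_sum \<mu> v)"
proof -
  have [measurable]: "cyl (ray_prefix v k) \<in> sets \<mu>" for k using assms cyl_sets by simp
  have "(\<integral>\<^sup>+u. neg_log2 (dist (End u) (End v)) \<partial>\<mu>) =
      (\<Sum>k. \<integral>\<^sup>+u. indicator (cyl (ray_prefix v (Suc k))) u \<partial>\<mu>)"
    unfolding neg_log2_dist by (rule nn_integral_suminf) measurable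
  then show ?thesis by (simp add: Sigma_inf_def cyl_sum_def)
qed

text \<open>Let j be the length of the meet. Then j < |u| \<le> |z| and j \<le> |y|, so the distance
  is at least 2^(-j) (1 - 1/4 - 1/2) = 2^(-j)/4. Hence the set of descendants of u is both open and
  closed, and its indicator is continuous.\<close>

lemma dist_prefix_of_ge:
  assumes "prefix_of u z" "\<not> prefix_of u y"
  shows "(1 / 2) ^ length u / 2 \<le> dist z y"
proof -
  have "\<not> enat (length u) \<le> meet_len z y"
    using assms prefix_of_unique le_meet_len by metis
  then obtain j where j: "meet_len z y = enat j" "j < length u"
    by (cases "meet_len z y") auto
  have "half_pow (vlen z) \<le> half_pow (enat (Suc j))"
    using prefix_of_len[OF assms(1)] j(2) by (intro half_pow_antimono) (metis Suc_leI enat_ord_simps(1) order_trans)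
  moreover have "half_pow (vlen y) \<le> half_pow (enat j)"
    using meet_len_le[of y z] j(1) by (intro half_pow_antimono) (simp add: meet_len_commute)
  moreover have "(1 / 2 :: real) ^ length u \<le> (1 / 2) ^ Suc j"
    using j(2) by (intro power_decreasing) auto
  moreover have "a / 2 \<le> p - (b + c) / 2" if "b \<le> 1 / 2 * p" "c \<le> p" "a \<le> 1 / 2 * p" for a b c p :: real
    using that by (simp add: field_simps)
  ultimately show ?thesis unfolding dist_vbar_def j(1) half_pow.simps power_Suc by blast
qed

lemma continuous_on_prefix_of: "continuous_on UNIV (\<lambda>z. indicator {z. prefix_of u z} z :: real)"
proof (unfold continuous_on_iff, intro ballI allI impI)
  fix x :: vbar and e :: real assume "e > 0"
  have "dist (indicator {z. prefix_of u z} y :: real) (indicator {z. prefix_of u z} x) < e"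
    if "dist y x < (1 / 2) ^ length u / 2" for y
  proof -
    have "\<not> (1 / 2) ^ length u / 2 \<le> dist x y" "\<not> (1 / 2) ^ length u / 2 \<le> dist y x"
      using that by (simp_all only: not_le dist_commute[of x y])
    then have "prefix_of u y \<longleftrightarrow> prefix_of u x" using dist_prefix_of_ge by blast
    then show ?thesis using \<open>e > 0\<close> by (cases "prefix_of u x") simp_all
  qed
  then show "\<exists>d>0. \<forall>y\<in>UNIV. dist y x < d \<longrightarrow>
      dist (indicator {z. prefix_of u z} y :: real) (indicator {z. prefix_of u z} x) < e"
    by (intro exI[of _ "(1 / 2) ^ length u / 2"] conjI ballI impI) simp_all
qed

text \<open>The indicator of the descendants of u is a bounded continuous test function. Its
  integral is the subtree ratio under the uniform law on the tree, and the mass of the cylinder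
  under the limit.\<close>

lemma subtree_ratio_tendsto:
  assumes w: "weakly_converges (\<lambda>n. distr (measure_pmf (pmf_of_set (x n))) borel Node) (distr \<mu> borel End)"
    and x: "\<And>n. n \<ge> 1 \<Longrightarrow> finite (x n) \<and> card (x n) = n"
    and \<mu>: "sets \<mu> = sets borel"
  shows "(\<lambda>n. real (subtree_size (x n) u) / real n) \<longlonglongrightarrow> measure \<mu> (cyl u)"
proof -
  let ?f = "\<lambda>z. indicator {z. prefix_of u z} z :: real"
  have meas [measurable]: "?f \<in> borel_measurable borel"
    using continuous_on_prefix_of by (rule borel_measurable_continuous_onI)
  have End [measurable]: "End \<in> measurable \<mu> borel"
    using measurable_End measurable_cong_sets[OF \<mu> refl] by blast
  have "bounded (range ?f)"
    by (rule boundedI[of _ 1]) (auto simp: indicator_def)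
  then have lim: "(\<lambda>n. \<integral>z. ?f z \<partial>distr (measure_pmf (pmf_of_set (x n))) borel Node) \<longlonglongrightarrow>
      (\<integral>z. ?f z \<partial>distr \<mu> borel End)"
    using w continuous_on_prefix_of unfolding weakly_converges_def by blast
  have f: "?f (End v) = indicator (cyl u) v" "?f (Node w) = indicator {w. prefix u w} w" for v w
    by (auto simp: cyl_def indicator_def)
  have "(\<integral>z. ?f z \<partial>distr \<mu> borel End) = (\<integral>v. indicator (cyl u) v \<partial>\<mu>)"
    unfolding f[symmetric] by (rule integral_distr) measurable
  also have "\<dots> = measure \<mu> (cyl u)"
    using sets_eq_imp_space_eq[OF \<mu>] by simp
  finally have r: "(\<integral>z. ?f z \<partial>distr \<mu> borel End) = measure \<mu> (cyl u)" .
  have l: "(\<integral>z. ?f z \<partial>distr (measure_pmf (pmf_of_set (x n))) borel Node) = real (subtree_size (x n) u) / real n"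
    if n: "n \<ge> 1" for n
  proof -
    have ne: "finite (x n)" "x n \<noteq> {}" "card (x n) = n" using x[OF n] n by auto
    have "(\<integral>z. ?f z \<partial>distr (measure_pmf (pmf_of_set (x n))) borel Node) =
        (\<integral>v. indicator {v. prefix u v} v \<partial>measure_pmf (pmf_of_set (x n)))"
      unfolding f[symmetric] by (rule integral_distr) measurable
    also have "\<dots> = measure (measure_pmf (pmf_of_set (x n))) {v. prefix u v}" by simp
    also have "\<dots> = real (card (x n \<inter> {v. prefix u v})) / real n"
      using ne by (simp add: measure_pmf_of_set)
    also have "x n \<inter> {v. prefix u v} = {v \<in> x n. prefix u v}" by auto
    finally show ?thesis by (simp add: subtree_size_def)
  qed
  have "eventually (\<lambda>n. (\<integral>z. ?f z \<partial>distr (measure_pmf (pmf_of_set (x n))) borel Node) =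
      real (subtree_size (x n) u) / real n) sequentially"
    using eventually_ge_at_top[of 1] by eventually_elim (rule l)
  then show ?thesis by (rule Lim_transform_eventually[OF lim[unfolded r]])
qed

text \<open>The cut-off is uniform in the ray. The later reduction of suprema over rays to
  conditions on nodes relies on this.\<close>

lemma metric_silhouette_finite_sum:
  assumes "finite x"
  shows "\<exists>K. \<forall>v. \<forall>N\<ge>K. (\<forall>k\<ge>N. subtree_size x (ray_prefix v (Suc k)) = 0) \<and>
    metric_silhouette x v = (\<Sum>k<N. real (subtree_size x (ray_prefix v (Suc k))))"
proof -
  \<comment> \<open>The sum of all lengths is a crude bound for the depth that also makes sense for
    the empty tree.\<close>
  define K where "K = (\<Sum>u\<in>x. length u)"
  have K: "length u \<le> K" if "u \<in> x" for u
    unfolding K_def using assms that by (intro member_le_sum) auto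
  have 0: "subtree_size x (ray_prefix v (Suc k)) = 0" if "k \<ge> K" for v k
  proof -
    have "\<not> prefix (ray_prefix v (Suc k)) u" if "u \<in> x" for u
      using K[OF that] \<open>k \<ge> K\<close> by (auto dest: prefix_length_le)
    then have "{u \<in> x. prefix (ray_prefix v (Suc k)) u} = {}" by blast
    then show ?thesis by (simp only: subtree_size_def card.empty)
  qed
  have "metric_silhouette x v = (\<Sum>k<N. real (subtree_size x (ray_prefix v (Suc k))))" if "N \<ge> K" for v N
    unfolding metric_silhouette_def by (rule suminf_finite) (use 0 that in auto)
  with 0 show ?thesis by (intro exI[of _ K] allI impI conjI) simp_all
qed

lemma summable_subtree_size: "finite x \<Longrightarrow> summable (\<lambda>k. real (subtree_size x (ray_prefix v (Suc k))))"
proof -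
  assume "finite x"
  from metric_silhouette_finite_sum[OF this] obtain K
    where K: "\<And>k. k \<ge> K \<Longrightarrow> subtree_size x (ray_prefix v (Suc k)) = 0" by blast
  show ?thesis by (rule summable_finite[of "{..<K}"]) (auto simp: K)
qed

section \<open>Hoelder continuity and uniform convergence from summable level bounds\<close>

lemma sup_norm_real_le:
  assumes "\<And>v. \<bar>f v - g v\<bar> \<le> C"
  shows "sup_norm (\<lambda>v. ereal (f v) - ereal (g v)) \<le> ennreal C"
  unfolding sup_norm_def
  by (rule SUP_least) (use assms in \<open>simp add: e2ennreal_ereal ennreal_leI\<close>)

lemma real_cyl_sum:
  assumes "finite_measure \<mu>" "summable y" "\<And>u. measure \<mu> (cyl u) \<le> y (length u)"
  shows "summable (\<lambda>k. measure \<mu> (cyl (ray_prefix v (Suc k))))"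
    and "cyl_sum \<mu> v = ennreal (\<Sum>k. measure \<mu> (cyl (ray_prefix v (Suc k))))"
proof -
  have le: "measure \<mu> (cyl (ray_prefix v (Suc k))) \<le> y (Suc k)" for k
    using assms(3)[of "ray_prefix v (Suc k)"] by simp
  show s: "summable (\<lambda>k. measure \<mu> (cyl (ray_prefix v (Suc k))))"
    by (rule summable_comparison_test'[OF summable_Suc_iff[THEN iffD2, OF assms(2)], of 0]) (simp add: le)
  show "cyl_sum \<mu> v = ennreal (\<Sum>k. measure \<mu> (cyl (ray_prefix v (Suc k))))"
    unfolding cyl_sum_def using s
    by (simp add: finite_measure.emeasure_eq_measure[OF assms(1)] suminf_ennreal2)
qed

text \<open>Two rays with a meet of length j share their first j terms. With q = 2^(-\<alpha>), the
  remaining differences sum to at most a constant times q^j, and q^j is the distance to the power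
  \<alpha>.\<close>

lemma hoelder_cyl_sum:
  assumes \<mu>: "\<And>u. measure \<mu> (cyl u) \<le> C * (1 / 2 powr \<alpha>) ^ length u" and "\<alpha> > 0"
  shows "hoelder \<alpha> (\<lambda>v. \<Sum>k. measure \<mu> (cyl (ray_prefix v (Suc k))))"
proof -
  define q where "q = 1 / 2 powr \<alpha>"
  have "2 powr \<alpha> > (1::real)" using assms(2) by simp
  then have q: "0 < q" "q < 1" by (auto simp: q_def)
  let ?m = "\<lambda>v k. measure \<mu> (cyl (ray_prefix v (Suc k)))"
  have m: "?m v k \<le> C * q ^ Suc k" for v k
    using \<mu>[of "ray_prefix v (Suc k)"] by (simp add: q_def)
  have sq: "summable (\<lambda>k. C * q ^ Suc k)"
    using q by (intro summable_mult summable_Suc_iff[THEN iffD2] summable_geometric) auto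
  have sm: "summable (?m v)" for v
    using m by (intro summable_comparison_test'[OF sq, of 0]) auto
  have "\<bar>(\<Sum>k. ?m u k) - (\<Sum>k. ?m v k)\<bar> \<le> C * q / (1 - q) * dist (End u) (End v) powr \<alpha>" if "u \<noteq> v" for u v
  proof -
    let ?j = "meet_len (End u) (End v)"
    have d: "dist (End u) (End v) = half_pow ?j" by (rule dist_End)
    moreover have "dist (End u) (End v) \<noteq> 0" using that by simp
    ultimately obtain j where j: "?j = enat j" by (cases ?j) auto
    have pre: "ray_prefix u (Suc k) = ray_prefix v (Suc k)" if "k < j" for k
    proof -
      have "dist (End u) (End v) < (1 / 2) ^ k"
        unfolding d j using that by (simp add: power_strict_decreasing_iff)
      then have "\<forall>i<Suc k. v i = u i" unfolding dist_End_less mem_cyl .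
      then show ?thesis by (simp add: ray_prefix_def)
    qed
    have b: "norm (?m u (k + j) - ?m v (k + j)) \<le> (C * q ^ Suc j) * q ^ k" for k
    proof -
      have "(C * q ^ Suc j) * q ^ k = C * q ^ Suc (k + j)" by (simp add: power_add mult_ac)
      moreover
      have "0 \<le> ?m u (k + j)" "0 \<le> ?m v (k + j)" by (rule measure_nonneg)+
      ultimately show ?thesis
        using m[of u "k + j"] m[of v "k + j"] unfolding real_norm_def abs_le_iff by linarith
    qed
    have sd: "summable (\<lambda>k. ?m u k - ?m v k)" by (intro summable_diff sm)
    have "(\<Sum>k. ?m u k) - (\<Sum>k. ?m v k) = (\<Sum>k. ?m u k - ?m v k)"
      by (rule suminf_diff[OF sm sm])
    also have "\<dots> = (\<Sum>k. ?m u (k + j) - ?m v (k + j)) + (\<Sum>k<j. ?m u k - ?m v k)"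
      by (rule suminf_split_initial_segment[OF sd])
    also have "(\<Sum>k<j. ?m u k - ?m v k) = 0" by (rule sum.neutral) (simp add: pre)
    finally have "\<bar>(\<Sum>k. ?m u k) - (\<Sum>k. ?m v k)\<bar> = norm (\<Sum>k. ?m u (k + j) - ?m v (k + j))" by simp
    also have "\<dots> \<le> (\<Sum>k. (C * q ^ Suc j) * q ^ k)"
      using q b by (intro norm_suminf_le summable_mult summable_geometric) auto
    also have "\<dots> = C * q ^ Suc j * (1 / (1 - q))"
      using q by (simp add: suminf_mult suminf_geometric summable_geometric)
    also have "\<dots> = C * q / (1 - q) * q ^ j" by simp
    also have "q ^ j = dist (End u) (End v) powr \<alpha>"
    proof -
      have "(1 / 2) powr \<alpha> = q" by (simp add: q_def powr_divide)
      moreover have "((1 / 2 :: real) ^ j) powr \<alpha> = ((1 / 2) powr \<alpha>) ^ j"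
        by (simp add: powr_realpow[symmetric] powr_powr mult.commute)
      ultimately show ?thesis unfolding d j by simp
    qed
    finally show ?thesis .
  qed
  then show ?thesis unfolding hoelder_def by blast
qed

text \<open>Distances are at most 1, so lowering the exponent enlarges the bound. This also reaches
  \<alpha> \<le> 0, which \<open>hoelder_cyl_sum\<close> excludes.\<close>

lemma hoelder_mono:
  assumes "hoelder \<beta> h" "\<alpha> \<le> \<beta>" shows "hoelder \<alpha> h"
proof -
  from assms(1) obtain C where C: "\<And>u v. u \<noteq> v \<Longrightarrow> \<bar>h u - h v\<bar> \<le> C * dist (End u) (End v) powr \<beta>"
    unfolding hoelder_def by blast
  have "\<bar>h u - h v\<bar> \<le> max C 0 * dist (End u) (End v) powr \<alpha>" if "u \<noteq> v" for u v
  proof -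
    have "dist (End u) (End v) \<le> 1"
      by (cases "meet_len (End u) (End v)") (auto simp: dist_End power_le_one)
    moreover have "0 < dist (End u) (End v)" using that by simp
    ultimately have "dist (End u) (End v) powr \<beta> \<le> dist (End u) (End v) powr \<alpha>"
      using assms(2) by (intro powr_mono') auto
    then have "max C 0 * dist (End u) (End v) powr \<beta> \<le> max C 0 * dist (End u) (End v) powr \<alpha>"
      by (intro mult_left_mono) auto
    moreover have "C * dist (End u) (End v) powr \<beta> \<le> max C 0 * dist (End u) (End v) powr \<beta>"
      by (intro mult_right_mono) auto
    ultimately show ?thesis using C[OF that] by linarith
  qed
  then show ?thesis unfolding hoelder_def by blast
qed

text \<open>The pathwise core of (c). The largest deviation on a level tends to 0, because levels
  are finite, and is at most \<open>y\<close> of that level; Tannery's theorem then handles the sum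
  over levels.\<close>

lemma sup_norm_silhouette:
  assumes x: "\<And>n. n \<ge> 1 \<Longrightarrow> finite (x n)"
    and \<mu>: "sets \<mu> = sets borel" "finite_measure \<mu>"
    and lim: "\<And>u. (\<lambda>n. real (subtree_size (x n) u) / real n) \<longlonglongrightarrow> measure \<mu> (cyl u)"
    and y: "summable y" "\<And>n u. n \<ge> 1 \<Longrightarrow> real (subtree_size (x n) u) / real n \<le> y (length u)"
  defines "D \<equiv> \<lambda>n. sup_norm (\<lambda>v. ereal (1 / real n * metric_silhouette (x n) v) - Sigma_inf \<mu> v)"
  shows "D \<longlonglongrightarrow> 0" and "n \<ge> 1 \<Longrightarrow> D n \<le> ennreal (\<Sum>k. y (Suc k))"
proof -
  let ?r = "\<lambda>n u. real (subtree_size (x n) u) / real n" and ?m = "\<lambda>u. measure \<mu> (cyl u)"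
  let ?S = "\<lambda>v. \<Sum>k. ?m (ray_prefix v (Suc k))"
  \<comment> \<open>One maximum per level serves all rays. The shift to \<open>Suc k\<close> is due
    to the silhouette leaving out the root.\<close>
  define \<delta> where "\<delta> k n = Max ((\<lambda>u. \<bar>?r n u - ?m u\<bar>) ` {u. length u = Suc k})" for k n
  have ne: "{u::node. length u = k} \<noteq> {}" for k by (auto intro: exI[of _ "replicate k True"])
  have my: "?m u \<le> y (length u)" for u
    by (rule LIMSEQ_le_const2[OF lim]) (use y(2) in blast)
  have ys: "summable (\<lambda>k. y (Suc k))" using y(1) by (simp add: summable_Suc_iff)
  have \<delta>_ge: "\<bar>?r n u - ?m u\<bar> \<le> \<delta> k n" if "length u = Suc k" for n u k
    unfolding \<delta>_def using that by (intro Max_ge) (auto simp: finite_level)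
  have \<delta>_nonneg: "0 \<le> \<delta> k n" for k n
    using \<delta>_ge[of "replicate (Suc k) True" k n] by force
  have \<delta>_le: "\<delta> k n \<le> y (Suc k)" if "n \<ge> 1" for k n
    unfolding \<delta>_def
  proof (subst Max_le_iff)
    show "\<forall>a\<in>(\<lambda>u. \<bar>?r n u - ?m u\<bar>) ` {u. length u = Suc k}. a \<le> y (Suc k)"
    proof (clarify)
      fix u :: node assume "length u = Suc k"
      then have "?r n u \<le> y (Suc k)" "?m u \<le> y (Suc k)" using y(2)[OF that, of u] my[of u] by auto
      moreover have "0 \<le> ?r n u" "0 \<le> ?m u" by auto
      ultimately show "\<bar>?r n u - ?m u\<bar> \<le> y (Suc k)" by linarith
    qed
  qed (use ne finite_level in auto)
  have \<delta>_lim: "(\<lambda>n. \<delta> k n) \<longlonglongrightarrow> 0" for k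
  proof (rule tendsto_sandwich[of "\<lambda>_. 0" _ _ "\<lambda>n. \<Sum>u | length u = Suc k. \<bar>?r n u - ?m u\<bar>"])
    have "(\<lambda>n. \<Sum>u | length u = Suc k. \<bar>?r n u - ?m u\<bar>) \<longlonglongrightarrow> (\<Sum>u::node | length u = Suc k. \<bar>?m u - ?m u\<bar>)"
      by (intro tendsto_sum tendsto_rabs tendsto_diff tendsto_const lim)
    then show "(\<lambda>n. \<Sum>u | length u = Suc k. \<bar>?r n u - ?m u\<bar>) \<longlonglongrightarrow> 0" by simp
    have "\<delta> k n \<le> (\<Sum>u | length u = Suc k. \<bar>?r n u - ?m u\<bar>)" for n
      unfolding \<delta>_def using ne finite_level
      by (subst Max_le_iff) (auto intro!: member_le_sum[of _ "{u. length u = Suc k}" "\<lambda>u. \<bar>?r n u - ?m u\<bar>"])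
    then show "eventually (\<lambda>n. \<delta> k n \<le> (\<Sum>u | length u = Suc k. \<bar>?r n u - ?m u\<bar>)) sequentially" by simp
  qed (use \<delta>_nonneg in auto)
  have \<delta>_summable: "summable (\<lambda>k. \<delta> k n)" if "n \<ge> 1" for n
    using \<delta>_le[OF that] \<delta>_nonneg by (intro summable_comparison_test'[OF ys, of 0]) auto
  have Sigma: "Sigma_inf \<mu> v = ereal (?S v)" for v
    unfolding Sigma_inf_eq[OF \<mu>(1)] real_cyl_sum(2)[OF \<mu>(2) y(1) my]
    by (simp add: suminf_nonneg real_cyl_sum(1)[OF \<mu>(2) y(1) my])
  have D_le: "D n \<le> ennreal (\<Sum>k. \<delta> k n)" if n: "n \<ge> 1" for n
    unfolding D_def Sigma
  proof (rule sup_norm_real_le)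
    fix v
    have s1: "summable (\<lambda>k. real (subtree_size (x n) (ray_prefix v (Suc k))))"
      by (rule summable_subtree_size[OF x[OF n]])
    then have s2: "summable (\<lambda>k. ?r n (ray_prefix v (Suc k)))" by (rule summable_divide)
    have s3: "summable (\<lambda>k. ?m (ray_prefix v (Suc k)))" by (rule real_cyl_sum(1)[OF \<mu>(2) y(1) my])
    have "1 / real n * metric_silhouette (x n) v = (\<Sum>k. ?r n (ray_prefix v (Suc k)))"
      unfolding metric_silhouette_def by (simp add: suminf_divide[OF s1])
    then have "\<bar>1 / real n * metric_silhouette (x n) v - ?S v\<bar> =
        norm (\<Sum>k. ?r n (ray_prefix v (Suc k)) - ?m (ray_prefix v (Suc k)))"
      by (simp add: suminf_diff[OF s2 s3])
    also have "\<dots> \<le> (\<Sum>k. \<delta> k n)"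
      by (rule norm_suminf_le[OF _ \<delta>_summable[OF n]]) (use \<delta>_ge in simp)
    finally show "\<bar>1 / real n * metric_silhouette (x n) v - ?S v\<bar> \<le> (\<Sum>k. \<delta> k n)" .
  qed
  have "((\<lambda>n. \<Sum>k. \<delta> k n) \<longlongrightarrow> (\<Sum>k. 0)) sequentially"
  proof (rule tannerys_theorem[THEN conjunct2, THEN conjunct2, OF \<delta>_lim _ ys])
    show "eventually (\<lambda>(k, n). norm (\<delta> k n) \<le> y (Suc k)) (at_top \<times>\<^sub>F sequentially)"
      unfolding eventually_prod_filter
      by (rule exI[of _ "\<lambda>_. True"], rule exI[of _ "\<lambda>n. n \<ge> 1"])
         (use \<delta>_le \<delta>_nonneg in \<open>auto intro: eventually_ge_at_top\<close>)
  qed simp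
  then have lim0: "(\<lambda>n. ennreal (\<Sum>k. \<delta> k n)) \<longlonglongrightarrow> 0"
    using tendsto_ennrealI by fastforce
  show "D \<longlonglongrightarrow> 0"
  proof (rule tendsto_sandwich[OF _ _ tendsto_const lim0])
    show "eventually (\<lambda>n. D n \<le> ennreal (\<Sum>k. \<delta> k n)) sequentially"
      using eventually_ge_at_top[of 1] by eventually_elim (rule D_le)
  qed simp
  show "D n \<le> ennreal (\<Sum>k. y (Suc k))" if "n \<ge> 1" for n
    using D_le[OF that] suminf_le[OF \<delta>_le[OF that] \<delta>_summable[OF that] ys]
    by (meson ennreal_leI order_trans)
qed

section \<open>Measurability of the supremum norms\<close>

text \<open>Partial sums are indexed by nodes instead of rays and levels, which leaves only
  countably many of them.\<close>

definition cyl_psum :: "ray measure \<Rightarrow> node \<Rightarrow> ennreal" where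
  "cyl_psum \<mu> u = (\<Sum>k<length u. emeasure \<mu> (cyl (take (Suc k) u)))"

lemma cyl_psum_ray_prefix:
  "cyl_psum \<mu> (ray_prefix v n) = (\<Sum>k<n. emeasure \<mu> (cyl (ray_prefix v (Suc k))))"
  unfolding cyl_psum_def by (intro sum.cong) (auto simp: take_Suc_ray_prefix)

lemma incseq_cyl_psum: "incseq (\<lambda>n. cyl_psum \<mu> (ray_prefix v n))"
  unfolding cyl_psum_ray_prefix by (rule incseq_SucI) simp

lemma cyl_sum_eq_SUP: "cyl_sum \<mu> v = (SUP n. cyl_psum \<mu> (ray_prefix v n))"
  unfolding cyl_psum_ray_prefix cyl_sum_def by (rule suminf_eq_SUP)

lemma sup_norm_Sigma_inf:
  assumes "sets \<mu> = sets borel"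
  shows "sup_norm (Sigma_inf \<mu>) = (SUP v. cyl_sum \<mu> v)"
  unfolding sup_norm_def Sigma_inf_eq[OF assms] by simp

text \<open>Every node is a prefix of some ray, so the supremum over rays and their levels runs over
  exactly the nodes.\<close>

lemma SUP_cyl_sum: "(SUP v. cyl_sum \<mu> v) = (SUP u. cyl_psum \<mu> u)"
proof (rule antisym)
  show "(SUP v. cyl_sum \<mu> v) \<le> (SUP u. cyl_psum \<mu> u)"
    unfolding cyl_sum_eq_SUP by (intro SUP_least SUP_upper) simp
  show "(SUP u. cyl_psum \<mu> u) \<le> (SUP v. cyl_sum \<mu> v)"
  proof (rule SUP_least)
    fix u :: node
    obtain v where v: "u = ray_prefix v (length u)" using node_eq_ray_prefix by blast
    have "cyl_psum \<mu> u \<le> cyl_sum \<mu> v"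
      unfolding cyl_sum_eq_SUP by (subst v) (rule SUP_upper, simp)
    also have "\<dots> \<le> (SUP v. cyl_sum \<mu> v)" by (rule SUP_upper) simp
    finally show "cyl_psum \<mu> u \<le> (SUP v. cyl_sum \<mu> v)" .
  qed
qed

section \<open>Compactness of the boundary\<close>

lemma compact_rays: "compact (UNIV :: ray set)"
proof -
  have "compact_space (product_topology (\<lambda>i::nat. euclidean :: bool topology) UNIV)"
    unfolding compact_space_product_topology
    by (intro disjI2 ballI) (simp add: compact_space_def finite_imp_compact)
  then have "compact_space (euclidean :: ray topology)"
    unfolding euclidean_product_topology .
  then show ?thesis by (simp add: compact_space_def)
qed

lemma open_prefix_determined: "open {v. Q (ray_prefix v N)}"
proof -
  have "{v. Q (ray_prefix v N)} = (\<Union>w\<in>{w. Q (ray_prefix w N)}. cyl (ray_prefix w N))"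
    by (auto simp: cyl_def)
  also have "open \<dots>" by (intro open_UN ballI open_cyl)
  finally show ?thesis .
qed

text \<open>The rays that have succeeded by level N form an open set. A finite number of these sets
  cover the boundary, and by monotonicity the largest index serves all rays.\<close>

lemma ray_uniform:
  assumes ex: "\<And>v. \<exists>N\<ge>K. Q (ray_prefix v N)"
    and mono: "\<And>v N N'. K \<le> N \<Longrightarrow> N \<le> N' \<Longrightarrow> Q (ray_prefix v N) \<Longrightarrow> Q (ray_prefix v N')"
  shows "\<exists>N\<ge>K. \<forall>v. Q (ray_prefix v N)"
proof -
  have "UNIV \<subseteq> (\<Union>N\<in>{K..}. {v. Q (ray_prefix v N)})" using ex by fastforce
  then obtain F where F: "F \<subseteq> {K..}" "finite F" "UNIV \<subseteq> (\<Union>N\<in>F. {v. Q (ray_prefix v N)})"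
    by (rule compactE_image[OF compact_rays open_prefix_determined])
  define N where "N = Max (insert K F)"
  have "N \<ge> K" "\<And>i. i \<in> F \<Longrightarrow> i \<le> N" using F(2) by (auto simp: N_def)
  moreover have "Q (ray_prefix v N)" for v
  proof -
    obtain i where "i \<in> F" "Q (ray_prefix v i)" using F(3) by blast
    then show ?thesis using mono[of i N v] F(1) calculation by auto
  qed
  ultimately show ?thesis by blast
qed

text \<open>The two one-sided inequalities avoid subtraction of extended numbers; for infinite s
  both sides are false.\<close>

lemma e2ennreal_abs_diff_le_iff:
  assumes "a \<ge> 0" "c \<ge> 0"
  shows "e2ennreal \<bar>ereal a - enn2ereal s\<bar> \<le> ennreal c \<longleftrightarrow>
    s \<le> ennreal a + ennreal c \<and> ennreal a \<le> s + ennreal c"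
proof (cases s rule: ennreal_cases)
  case (real r)
  have "e2ennreal \<bar>ereal a - enn2ereal s\<bar> = ennreal \<bar>a - r\<bar>"
    using real by (simp add: e2ennreal_ereal)
  then show ?thesis
    using real assms by (simp add: ennreal_le_iff abs_le_iff ac_simps flip: ennreal_plus) argo
qed (use assms in \<open>auto simp: e2ennreal_infty top_unique simp flip: ennreal_plus\<close>)

text \<open>
  Reduces the uncountable supremum to conditions on the countably many nodes. The second condition
  rests on compactness, in the manner of Dini's theorem.
\<close>

lemma sup_norm_diff_le_iff:
  fixes a :: "ray \<Rightarrow> real" and A :: "node \<Rightarrow> real" and P :: "node \<Rightarrow> ennreal"
  assumes a: "\<And>v N. N \<ge> K \<Longrightarrow> a v = A (ray_prefix v N)" and A: "\<And>u. A u \<ge> 0" and c: "c \<ge> 0"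
    and P: "\<And>v. incseq (\<lambda>n. P (ray_prefix v n))" and S: "\<And>v. S v = (SUP n. P (ray_prefix v n))"
  shows "sup_norm (\<lambda>v. ereal (a v) - enn2ereal (S v)) \<le> ennreal c \<longleftrightarrow>
    (\<forall>u. length u \<ge> K \<longrightarrow> P u \<le> ennreal (A u) + ennreal c) \<and>
    (\<forall>i::nat. \<exists>N\<ge>K. \<forall>u. length u = N \<longrightarrow> ennreal (A u) \<le> P u + ennreal c + ennreal (1 / real (Suc i)))"
proof -
  have a0: "a v \<ge> 0" for v using a[OF order_refl] A by simp
  have PS: "P (ray_prefix v n) \<le> S v" for v n unfolding S by (rule SUP_upper) simp
  have "sup_norm (\<lambda>v. ereal (a v) - enn2ereal (S v)) \<le> ennreal c \<longleftrightarrow>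
      (\<forall>v. S v \<le> ennreal (a v) + ennreal c) \<and> (\<forall>v. ennreal (a v) \<le> S v + ennreal c)"
    unfolding sup_norm_def SUP_le_iff by (auto simp: e2ennreal_abs_diff_le_iff a0 c)
  moreover have "(\<forall>v. S v \<le> ennreal (a v) + ennreal c) \<longleftrightarrow>
      (\<forall>u. length u \<ge> K \<longrightarrow> P u \<le> ennreal (A u) + ennreal c)"
  proof (intro iffI allI impI)
    fix u :: node assume L: "\<forall>v. S v \<le> ennreal (a v) + ennreal c" and u: "length u \<ge> K"
    obtain v where v: "u = ray_prefix v (length u)" using node_eq_ray_prefix by blast
    have "P u \<le> S v" using PS[of v "length u"] v by simp
    then show "P u \<le> ennreal (A u) + ennreal c" using L a[OF u, of v] v by (metis order_trans)
  next
    fix v assume R: "\<forall>u. length u \<ge> K \<longrightarrow> P u \<le> ennreal (A u) + ennreal c"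
    show "S v \<le> ennreal (a v) + ennreal c"
      unfolding S
    proof (rule SUP_least)
      fix n
      have "P (ray_prefix v n) \<le> P (ray_prefix v (max K n))" using P by (rule incseqD) simp
      also have "\<dots> \<le> ennreal (a v) + ennreal c"
        using R[rule_format, of "ray_prefix v (max K n)"] a[of "max K n" v] by simp
      finally show "P (ray_prefix v n) \<le> ennreal (a v) + ennreal c" .
    qed
  qed
  moreover have "(\<forall>v. ennreal (a v) \<le> S v + ennreal c) \<longleftrightarrow>
      (\<forall>i::nat. \<exists>N\<ge>K. \<forall>u. length u = N \<longrightarrow> ennreal (A u) \<le> P u + ennreal c + ennreal (1 / real (Suc i)))"
    (is "?L \<longleftrightarrow> ?R")
  proof
    assume R: ?R
    show ?L
    proof (rule allI, rule ennreal_le_epsilon)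
      fix v and e :: real assume "0 < e"
      then obtain i where i: "1 / real (Suc i) < e" using nat_approx_posE by metis
      obtain N where N: "N \<ge> K" "\<And>u. length u = N \<Longrightarrow> ennreal (A u) \<le> P u + ennreal c + ennreal (1 / real (Suc i))"
        using R by blast
      have "ennreal (a v) \<le> P (ray_prefix v N) + ennreal c + ennreal (1 / real (Suc i))"
        using N(2)[of "ray_prefix v N"] a[OF N(1)] by simp
      also have "\<dots> \<le> S v + ennreal c + ennreal e"
        using i by (intro add_mono PS ennreal_leI) auto
      finally show "ennreal (a v) \<le> S v + ennreal c + ennreal e" .
    qed
  next
    assume L: ?L
    show ?R
    proof
      fix i :: nat
      \<comment> \<open>The slack is needed since a finite level reaches the supremum
        \<open>S v\<close> only approximately.\<close>
      let ?e = "1 / real (Suc i)"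
      define Q where "Q u \<longleftrightarrow> ennreal (A u) \<le> P u + ennreal c + ennreal ?e" for u
      have "\<exists>N\<ge>K. \<forall>v. Q (ray_prefix v N)"
      proof (rule ray_uniform)
        fix v
        show "\<exists>N\<ge>K. Q (ray_prefix v N)"
        proof (rule ccontr)
          assume "\<not> ?thesis"
          \<comment> \<open>If no level works, all partial sums, and hence \<open>S v\<close>, stay
            below \<open>a v\<close> by at least c plus the slack, against
            \<open>?L\<close>.\<close>
          then have lt: "P (ray_prefix v N) + ennreal c + ennreal ?e < ennreal (a v)" if "N \<ge> K" for N
            using a[OF that] that unfolding Q_def not_le[symmetric] by metis
          have "S v + (ennreal c + ennreal ?e) \<le> ennreal (a v)"
            unfolding S
          proof (subst ennreal_SUP_add_left[symmetric])
            show "(SUP n. P (ray_prefix v n) + (ennreal c + ennreal ?e)) \<le> ennreal (a v)"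
            proof (rule SUP_least)
              fix n
              have "P (ray_prefix v n) \<le> P (ray_prefix v (max K n))" using P by (rule incseqD) simp
              then have "P (ray_prefix v n) + (ennreal c + ennreal ?e) \<le>
                  P (ray_prefix v (max K n)) + ennreal c + ennreal ?e"
                by (simp add: add.assoc add_right_mono)
              also have "\<dots> \<le> ennreal (a v)" using lt[of "max K n"] by simp
              finally show "P (ray_prefix v n) + (ennreal c + ennreal ?e) \<le> ennreal (a v)" .
            qed
          qed simp
          also have "\<dots> \<le> S v + ennreal c" using L by blast
          finally have le: "S v + (ennreal c + ennreal ?e) \<le> S v + ennreal c" .
          \<comment> \<open>Finiteness of \<open>S v\<close> allows it to be cancelled in
            \<open>le\<close>.\<close>
          have "S v < top"
            using \<open>S v + (ennreal c + ennreal ?e) \<le> ennreal (a v)\<close>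
            by (metis ennreal_add_eq_top ennreal_less_top infinity_ennreal_def leD less_top)
          then obtain s where s: "S v = ennreal s" "s \<ge> 0" by (cases "S v" rule: ennreal_cases) auto
          have "0 < ?e" by simp
          then show False using le s c by (simp add: ennreal_le_iff del: of_nat_Suc flip: ennreal_plus)
        qed
      next
        \<comment> \<open>From level K on, \<open>A\<close> has the constant value
          \<open>a v\<close> along the ray, while \<open>P\<close> increases.\<close>
        fix v N N' assume N: "K \<le> N" "N \<le> N'" "Q (ray_prefix v N)"
        have "P (ray_prefix v N) \<le> P (ray_prefix v N')" using P N(2) by (rule incseqD)
        then show "Q (ray_prefix v N')"
          using N a[of N v] a[of N' v] unfolding Q_def by (simp add: add_right_mono) (meson add_right_mono order_trans)
      qed
      then obtain N where N: "N \<ge> K" "\<And>v. Q (ray_prefix v N)" by blast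
      have "Q u" if "length u = N" for u
        using N(2) node_eq_ray_prefix[of u] that by metis
      then show "\<exists>N\<ge>K. \<forall>u. length u = N \<longrightarrow> ennreal (A u) \<le> P u + ennreal c + ennreal ?e"
        using N(1) unfolding Q_def by blast
    qed
  qed
  ultimately show ?thesis by blast
qed

section \<open>Measurability in the random measure\<close>

lemma measurable_cyl_psum:
  assumes "Z \<in> measurable M (prob_algebra borel)"
  shows "(\<lambda>\<omega>. cyl_psum (Z \<omega>) u) \<in> borel_measurable M"
proof -
  have "(\<lambda>\<omega>. emeasure (Z \<omega>) (cyl w)) \<in> borel_measurable M" for w
  proof (rule measurable_compose[OF measurable_prob_algebraD[OF assms] measurable_emeasure_subprob_algebra])
    show "cyl w \<in> sets borel" using cyl_sets node_eq_ray_prefix[of w] by metis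
  qed
  then show ?thesis unfolding cyl_psum_def by simp
qed

lemma prob_algebraD:
  assumes "Z \<in> measurable M (prob_algebra borel)" "\<omega> \<in> space M"
  shows "sets (Z \<omega>) = sets borel" "prob_space (Z \<omega>)"
  using measurable_space[OF assms] by (auto simp: space_prob_algebra)

lemma measurable_sup_norm_Sigma_inf:
  assumes "Z \<in> measurable M (prob_algebra borel)"
  shows "(\<lambda>\<omega>. sup_norm (Sigma_inf (Z \<omega>))) \<in> borel_measurable M"
proof (subst measurable_cong)
  show "sup_norm (Sigma_inf (Z \<omega>)) = (SUP u. cyl_psum (Z \<omega>) u)" if "\<omega> \<in> space M" for \<omega>
    using sup_norm_Sigma_inf[OF prob_algebraD(1)[OF assms that]] SUP_cyl_sum by simp
  show "(\<lambda>\<omega>. SUP u. cyl_psum (Z \<omega>) u) \<in> borel_measurable M"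
    by (intro borel_measurable_SUP measurable_cyl_psum[OF assms]) auto
qed

text \<open>With the tree fixed, sublevel sets are countable combinations of events about partial
  sums at nodes. The random tree is inserted later, using that \<open>trees\<close> is
  countable.\<close>

lemma measurable_sup_norm_tree:
  assumes Z: "Z \<in> measurable M (prob_algebra borel)" and x: "finite x"
  shows "(\<lambda>\<omega>. sup_norm (\<lambda>v. ereal (1 / real n * metric_silhouette x v) - Sigma_inf (Z \<omega>) v)) \<in> borel_measurable M"
proof -
  let ?a = "\<lambda>v. 1 / real n * metric_silhouette x v"
  define A where "A u = 1 / real n * (\<Sum>k<length u. real (subtree_size x (take (Suc k) u)))" for u
  obtain K where K: "\<And>v N. N \<ge> K \<Longrightarrow> metric_silhouette x v = (\<Sum>k<N. real (subtree_size x (ray_prefix v (Suc k))))"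
    using metric_silhouette_finite_sum[OF x] by blast
  have aA: "?a v = A (ray_prefix v N)" if "N \<ge> K" for v N
    unfolding A_def K[OF that] by (intro arg_cong2[where f="(*)"] sum.cong) (auto simp: take_Suc_ray_prefix)
  have A0: "A u \<ge> 0" for u by (simp add: A_def sum_nonneg)
  note [measurable] = measurable_cyl_psum[OF Z]
  have eq: "sup_norm (\<lambda>v. ereal (?a v) - Sigma_inf (Z \<omega>) v) \<le> ennreal c \<longleftrightarrow>
    (\<forall>u. length u \<ge> K \<longrightarrow> cyl_psum (Z \<omega>) u \<le> ennreal (A u) + ennreal c) \<and>
    (\<forall>i::nat. \<exists>N\<ge>K. \<forall>u. length u = N \<longrightarrow> ennreal (A u) \<le> cyl_psum (Z \<omega>) u + ennreal c + ennreal (1 / real (Suc i)))"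
    if "\<omega> \<in> space M" "c \<ge> 0" for \<omega> c
    unfolding Sigma_inf_eq[OF prob_algebraD(1)[OF Z that(1)]]
    by (rule sup_norm_diff_le_iff[where a = "?a" and A = A and P = "cyl_psum (Z \<omega>)" and S = "cyl_sum (Z \<omega>)"])
       (fact aA A0 that(2) incseq_cyl_psum cyl_sum_eq_SUP)+
  show ?thesis
  proof (rule borel_measurableI_le)
    fix y :: ennreal
    show "{\<omega> \<in> space M. sup_norm (\<lambda>v. ereal (?a v) - Sigma_inf (Z \<omega>) v) \<le> y} \<in> sets M"
    proof (cases y rule: ennreal_cases)
      case (real c)
      have "{\<omega> \<in> space M. sup_norm (\<lambda>v. ereal (?a v) - Sigma_inf (Z \<omega>) v) \<le> y} = {\<omega> \<in> space M.
        (\<forall>u. length u \<ge> K \<longrightarrow> cyl_psum (Z \<omega>) u \<le> ennreal (A u) + ennreal c) \<and>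
        (\<forall>i::nat. \<exists>N\<ge>K. \<forall>u. length u = N \<longrightarrow> ennreal (A u) \<le> cyl_psum (Z \<omega>) u + ennreal c + ennreal (1 / real (Suc i)))}"
        using eq real by blast
      also have "\<dots> \<in> sets M" by measurable
      finally show ?thesis .
    qed simp
  qed
qed

section \<open>Asymptotics of the metric silhouette\<close>

theorem theorem8:
  fixes M :: "'w measure"
    and X :: "nat \<Rightarrow> 'w \<Rightarrow> node set"
    and Xinf :: "'w \<Rightarrow> ray measure"
  assumes "prob_space M"
    and "bst_chain M X"
    and "bst_limit M X Xinf"
  shows
    "((\<lambda>\<omega>. sup_norm (Sigma_inf (Xinf \<omega>))) \<in> borel_measurable M \<and>
      (\<integral>\<^sup>+\<omega>. sup_norm (Sigma_inf (Xinf \<omega>)) \<partial>M) < \<infinity>) \<and>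
     (AE \<omega> in M. (\<forall>v. \<bar>Sigma_inf (Xinf \<omega>) v\<bar> \<noteq> \<infinity>) \<and>
        (\<forall>\<alpha><alpha0. hoelder \<alpha> (\<lambda>v. real_of_ereal (Sigma_inf (Xinf \<omega>) v)))) \<and>
     (let D = \<lambda>n \<omega>. sup_norm (\<lambda>v. ereal (1 / real n * metric_silhouette (X n \<omega>) v)
                                    - Sigma_inf (Xinf \<omega>) v)
      in (AE \<omega> in M. (\<lambda>n. D n \<omega>) \<longlonglongrightarrow> 0) \<and>
         (\<forall>n\<ge>1. D n \<in> borel_measurable M) \<and>
         (\<lambda>n. \<integral>\<^sup>+\<omega>. D n \<omega> \<partial>M) \<longlonglongrightarrow> 0)"
proof -
  interpret bst_process M X
    using assms(1,2) by (simp add: bst_process_def bst_process_axioms_def)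
  have Xinf: "Xinf \<in> measurable M (prob_algebra borel)" using assms(3) by (simp add: bst_limit_def)
  define D where "D n \<omega> = sup_norm (\<lambda>v. ereal (1 / real n * metric_silhouette (X n \<omega>) v) - Sigma_inf (Xinf \<omega>) v)" for n \<omega>
  define B where "B \<omega> = (\<Sum>k. level_sup (Suc k) \<omega>)" for \<omega>
  define y where "y \<omega> k = enn2real (level_sup k \<omega>)" for \<omega> k
  \<comment> \<open>Countably many positive exponents increasing to \<open>alpha0\<close> suffice,
    so that one almost sure event serves every \<alpha> < \<open>alpha0\<close>.\<close>
  define \<beta> where "\<beta> m = alpha0 * (real (Suc m) / real (Suc (Suc m)))" for m
  have a0: "alpha0 > 0" using alpha0_bounds by simp
  have \<beta>: "0 < \<beta> m" "\<beta> m < alpha0" for m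
    unfolding \<beta>_def using a0 mult_strict_left_mono[of "real (Suc m) / real (Suc (Suc m))" 1 alpha0] by simp_all
  \<comment> \<open>The tree takes countably many values, so it may be held fixed.\<close>
  have D_meas: "D n \<in> borel_measurable M" if "n \<ge> 1" for n
    unfolding D_def
    by (rule measurable_compose_countable'[OF measurable_sup_norm_tree[OF Xinf] measurable_X[OF that] countable_trees]) simp
  have B_meas [measurable]: "B \<in> borel_measurable M" unfolding B_def by measurable
  have B_int: "(\<integral>\<^sup>+\<omega>. B \<omega> \<partial>M) < \<infinity>" unfolding B_def by (rule nn_integral_suminf_level_sup)
  have "AE \<omega> in M. B \<omega> \<noteq> \<infinity>" using nn_integral_PInf_AE[OF B_meas] B_int by simp
  moreover have "AE \<omega> in M. \<exists>C. \<forall>k. level_sup k \<omega> \<le> ennreal (C * (1 / 2 powr \<beta> m) ^ k)" for m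
  proof (rule AE_level_sup_geometric)
    have "2 powr \<beta> m < 2 powr alpha0" using \<beta> by simp
    also have "\<dots> = rho0" using rho0_bounds by (simp add: alpha0_def)
    finally show "2 powr \<beta> m < rho0" .
  qed simp
  then have "AE \<omega> in M. \<forall>m. \<exists>C. \<forall>k. level_sup k \<omega> \<le> ennreal (C * (1 / 2 powr \<beta> m) ^ k)"
    by (simp add: AE_all_countable)
  moreover have "AE \<omega> in M. weakly_converges (\<lambda>n. distr (measure_pmf (pmf_of_set (X n \<omega>))) borel Node) (distr (Xinf \<omega>) borel End)"
    using assms(3) by (simp add: bst_limit_def)
  \<comment> \<open>All pathwise claims are collected on one almost sure event, with
    \<open>B\<close> as the common integrable majorant.\<close>
  ultimately have main: "AE \<omega> in M. (\<lambda>n. D n \<omega>) \<longlonglongrightarrow> 0 \<and> (\<forall>n\<ge>1. D n \<omega> \<le> B \<omega>) \<and>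
    sup_norm (Sigma_inf (Xinf \<omega>)) \<le> B \<omega> \<and> (\<forall>v. \<bar>Sigma_inf (Xinf \<omega>) v\<bar> \<noteq> \<infinity>) \<and>
    (\<forall>\<alpha><alpha0. hoelder \<alpha> (\<lambda>v. real_of_ereal (Sigma_inf (Xinf \<omega>) v)))"
    using AE_all_trees_of_card AE_space
  proof eventually_elim
    case (elim \<omega>)
    note fin = elim(1) and geo = elim(2) and weak = elim(3) and tree = elim(4) and \<omega> = elim(5)
    note \<mu> = prob_algebraD[OF Xinf \<omega>]
    interpret \<mu>: prob_space "Xinf \<omega>" by (rule \<mu>(2))
    have x: "finite (X n \<omega>)" "card (X n \<omega>) = n" if "n \<ge> 1" for n
      using tree that by (auto simp: trees_of_card_def)
    have lim: "(\<lambda>n. real (subtree_size (X n \<omega>) u) / real n) \<longlonglongrightarrow> measure (Xinf \<omega>) (cyl u)" for u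
      by (rule subtree_ratio_tendsto[OF weak _ \<mu>(1)]) (simp add: x)
    have y: "level_sup k \<omega> = ennreal (y \<omega> k)" for k
      using level_sup_le_1[OF tree, of k] unfolding y_def
      by (subst ennreal_enn2real) (auto intro: le_less_trans)
    have y0: "y \<omega> k \<ge> 0" for k by (simp add: y_def)
    have sy': "summable (\<lambda>k. y \<omega> (Suc k))"
      using fin y0 unfolding B_def y by (intro summable_suminf_not_top) auto
    then have sy: "summable (y \<omega>)" by (simp add: summable_Suc_iff)
    have B: "B \<omega> = ennreal (\<Sum>k. y \<omega> (Suc k))"
      unfolding B_def y using y0 sy' by (intro suminf_ennreal2) auto
    have ry: "real (subtree_size (X n \<omega>) u) / real n \<le> y \<omega> (length u)" if "n \<ge> 1" for n u
      using ratio_le_level_sup[OF that, of \<omega> u] y0 unfolding y by (simp add: ennreal_le_iff)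
    have my: "measure (Xinf \<omega>) (cyl u) \<le> y \<omega> (length u)" for u
      by (rule LIMSEQ_le_const2[OF lim]) (use ry in blast)
    note sil = sup_norm_silhouette[OF x(1) \<mu>(1) \<mu>.finite_measure_axioms lim sy ry]
    note cs = real_cyl_sum[OF \<mu>.finite_measure_axioms sy my]
    let ?S = "\<lambda>v. \<Sum>k. measure (Xinf \<omega>) (cyl (ray_prefix v (Suc k)))"
    have Sigma: "Sigma_inf (Xinf \<omega>) v = ereal (?S v)" for v
      unfolding Sigma_inf_eq[OF \<mu>(1)] cs(2) by (simp add: suminf_nonneg cs(1))
    have "hoelder \<alpha> ?S" if "\<alpha> < alpha0" for \<alpha>
    proof -
      have "\<beta> \<longlonglongrightarrow> alpha0 * 1"
        unfolding \<beta>_def by (intro tendsto_mult tendsto_const LIMSEQ_Suc[OF LIMSEQ_n_over_Suc_n])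
      then have "eventually (\<lambda>m. \<alpha> < \<beta> m) sequentially" using that by (intro order_tendstoD) auto
      then obtain m where m: "\<alpha> < \<beta> m" by (auto simp: eventually_sequentially)
      obtain C where C: "\<And>k. level_sup k \<omega> \<le> ennreal (C * (1 / 2 powr \<beta> m) ^ k)" using geo by blast
      have "measure (Xinf \<omega>) (cyl u) \<le> max C 0 * (1 / 2 powr \<beta> m) ^ length u" for u
      proof -
        \<comment> \<open>Negative reals become 0 under \<open>ennreal\<close>; passing to
          \<open>max C 0\<close> lets the bound return to the reals.\<close>
        have "ennreal (y \<omega> (length u)) \<le> ennreal (C * (1 / 2 powr \<beta> m) ^ length u)" using C y by metis
        also have "\<dots> \<le> ennreal (max C 0 * (1 / 2 powr \<beta> m) ^ length u)"
          by (intro ennreal_leI mult_right_mono) auto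
        finally have "y \<omega> (length u) \<le> max C 0 * (1 / 2 powr \<beta> m) ^ length u"
          by (subst (asm) ennreal_le_iff) auto
        then show ?thesis using my[of u] by linarith
      qed
      then have "hoelder (\<beta> m) ?S" using \<beta>(1) by (rule hoelder_cyl_sum)
      then show ?thesis by (rule hoelder_mono) (use m in simp)
    qed
    moreover have "sup_norm (Sigma_inf (Xinf \<omega>)) \<le> B \<omega>"
      unfolding sup_norm_Sigma_inf[OF \<mu>(1)] cs(2) B
      by (intro SUP_least ennreal_leI suminf_le) (use my[of "ray_prefix _ (Suc _)"] cs(1) sy' in auto)
    moreover have "(\<lambda>n. D n \<omega>) \<longlonglongrightarrow> 0" unfolding D_def by (rule sil(1))
    moreover have "D n \<omega> \<le> B \<omega>" if "n \<ge> 1" for n unfolding D_def B by (rule sil(2)[OF _ _ that])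
    ultimately show ?case by (simp add: Sigma)
  qed
  have "(\<integral>\<^sup>+\<omega>. sup_norm (Sigma_inf (Xinf \<omega>)) \<partial>M) \<le> (\<integral>\<^sup>+\<omega>. B \<omega> \<partial>M)"
    by (rule nn_integral_mono_AE, use main in eventually_elim) simp
  then have "(\<integral>\<^sup>+\<omega>. sup_norm (Sigma_inf (Xinf \<omega>)) \<partial>M) < \<infinity>" using B_int by (rule le_less_trans)
  moreover have "(\<lambda>n. \<integral>\<^sup>+\<omega>. D n \<omega> \<partial>M) \<longlonglongrightarrow> 0"
  \<comment> \<open>The sequence is shifted by one, since nothing is known about
    \<open>X 0\<close>.\<close>
  proof (rule LIMSEQ_imp_Suc)
    have "(\<lambda>n. \<integral>\<^sup>+\<omega>. D (Suc n) \<omega> \<partial>M) \<longlonglongrightarrow> (\<integral>\<^sup>+\<omega>. 0 \<partial>M)"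
    proof (rule nn_integral_dominated_convergence[where w=B])
      show "AE \<omega> in M. (\<lambda>n. D (Suc n) \<omega>) \<longlonglongrightarrow> 0"
        using main by eventually_elim (auto intro: LIMSEQ_Suc)
      show "AE \<omega> in M. D (Suc n) \<omega> \<le> B \<omega>" for n
        using main by eventually_elim auto
    qed (use D_meas B_int in auto)
    then show "(\<lambda>n. \<integral>\<^sup>+\<omega>. D (Suc n) \<omega> \<partial>M) \<longlonglongrightarrow> 0" by simp
  qed
  moreover have "AE \<omega> in M. (\<lambda>n. D n \<omega>) \<longlonglongrightarrow> 0" using main by eventually_elim simp
  moreover have "AE \<omega> in M. (\<forall>v. \<bar>Sigma_inf (Xinf \<omega>) v\<bar> \<noteq> \<infinity>) \<and>
      (\<forall>\<alpha><alpha0. hoelder \<alpha> (\<lambda>v. real_of_ereal (Sigma_inf (Xinf \<omega>) v)))"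
    using main by eventually_elim simp
  ultimately show ?thesis
    using measurable_sup_norm_Sigma_inf[OF Xinf] D_meas unfolding Let_def D_def[abs_def] by blast
qed

end
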